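(* Consider the finite memory change-point model with $\kappa\ge0$ fixed, with $\Psi=\Psi_\alpha$ and $\pi_0$ allowed to depend on $\alpha\in(0,1)$, and assume that there is a constant $c\in(0,1)$ such that $\sup_{t\ge0,z\in[K]^t}\pi_t(z;\alpha)\le1-c$ for all small enough $\alpha$. Let $z_0^*,\Xi_1^*,\Xi_2^*$ be the optimal choices defined in the context. Then: (a) with $\lambda^*=\inf_{\mathcal X}\mathsf E[\Theta_{\mathcal X}]$ (infimum over all assignment rules), $\lambda^*=\lambda(z_0^*,\Xi_1^* )$ and $\alpha\,\widetilde\lambda(\Xi_1^* )=o(\lambda^*+|\log\alpha|)$ as $\alpha\to0$; (b) with $\mathsf D^*=\mathsf D(\Xi_2^* )$, one has $\mathsf D^*=O(1)$ and, for every $\epsilon\in(0,1)$, with $N_{\epsilon,\alpha}=\lfloor(1-\epsilon)|\log\alpha|/\mathsf D^*\rfloor$, $$\limsup_{\alpha\to0}\ \sup_{t\ge0,\,\mathcal X}\ \frac1{\mathsf D^*N_{\epsilon,\alpha}}\sum_{s=1}^{N_{\epsilon,\alpha}}\big(I_{X_{t+s}}+\omega(\Pi_{t+s}(\mathcal X))\big)\le1+\epsilon/2,$$ the supremum being over all assignment rules $\mathcal X=\{X_t\}$.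
   Context: Setup. Fix $2\le K<\infty$, $[K]=\{1,\dots,K\}$, $\mathbb N=\{1,2,\dots\}$. There is a latent process $L_t\in\{0,1\}$, $t\ge0$, with $L_t=0$ for $t<\Theta$ and $L_t=1$ for $t\ge\Theta$ ($\Theta=\Theta_{\mathcal X}$ is the change-point). At each $t\in\mathbb N$ a treatment $X_t\in[K]$ is selected and a response $Y_t$ in a Polish space $\mathbb Y$ is observed; $\mathcal F_t=\sigma(X_s,Y_s:1\le s\le t)$, $\mathcal F_0$ trivial. An assignment rule $\mathcal X=\{X_t\}$ has $X_1$ deterministic and $X_t$ a measurable function of $X_1,\dots,X_{t-1},Y_1,\dots,Y_{t-1}$. Response model (not depending on $\alpha$): for each $x\in[K]$, $f_x,g_x$ are densities with respect to a $\sigma$-finite measure $\mu$ on $\mathbb Y$; given $X_t=x,L_t=i,\mathcal F_{t-1},L_0,\dots,L_{t-1}$, $Y_t$ has density $f_x$ if $i=0$, $g_x$ if $i=1$; $I_x=\int\log(g_x/f_x)g_x\,d\mu\in(0,\infty)$. Change-point model: $\mathsf P(L_0=1)=\pi_0\in[0,1)$, $\mathsf P(L_t=1\mid L_{t-1}=0,\mathcal F_{t-1},X_t)=\Pi_t=\Pi_t(\mathcal X)=\pi_t(X_1,\dots,X_t)$. Finite memory model: $\Pi_t=\Psi(X_t,\mathbb S_{t-1})$ with $\mathbb S_t=\Phi(X_t,\mathbb S_{t-1})$, $\Phi(x,(x_\kappa,\dots,x_1))=(x,x_\kappa,\dots,x_2)$, for a given initial state $\mathbb S_0\in[K]^\kappa$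 and $\Psi:[K]\times[K]^\kappa\to[0,1)$. So $\pi_t(x_1,\dots,x_t)=\Psi(x_t,x_{t-1},\dots,x_{t-\kappa})$, entries with non-positive index being taken from $\mathbb S_0$. A block of length $\ell$ is $\Xi\in[K]^\ell$, extended cyclically: $\Xi(j\ell+i)=\Xi(i)$; $\Xi(1:s)=(\Xi(1),\dots,\Xi(s))$; $z_0(1:s)$ is the first $s$ entries of $z_0$. $\omega(x)=|\log(1-x)|$; $I(\Xi)=\frac1\ell\sum_{i=1}^\ell I_{\Xi(i)}$; $d(\Xi)=\frac1\ell\sum_{j=1}^\ell\omega(\Psi(\Xi(j),\Xi(j-1),\dots,\Xi(j-\kappa)))$; $\mathsf D(\Xi)=I(\Xi)+d(\Xi)$; $\widetilde\lambda(\Xi)=\sup_{m\ge0,z\in[K]^m}\{1+\sum_{t\ge1}\prod_{s=1}^t(1-\pi_{m+s}(z,\Xi(1:s)))\}$; for $z_0\in[K]^{t_0}$, $$\lambda(z_0,\Xi)=(1-\pi_0)\Big[1+\sum_{t=1}^{t_0}\prod_{s=1}^t(1-\pi_s(z_0(1:s)))+\sum_{t=t_0+1}^\infty\prod_{s=1}^{t_0}(1-\pi_s(z_0(1:s)))\prod_{s=t_0+1}^t(1-\pi_s(z_0,\Xi(1:s-t_0)))\Big].$$ Optimal $z_0^*,\Xi_1^*$. Let $V^*(\mathbb S)=\inf_{(x_1,x_2,\dots)\in[K]^\infty}\sum_{t\ge1}\prod_{s=1}^t(1-\Psi(x_s,\mathbb S_{s-1}))$ with $\mathbb S_0=\mathbb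 S$, $\mathbb S_t=\Phi(x_t,\mathbb S_{t-1})$; $\upsilon^*(\mathbb S)\in\arg\min_{x\in[K]}(1-\Psi(x,\mathbb S))(1+V^*(\Phi(x,\mathbb S)))$. Starting from the model's initial state $\mathbb S_0^*=\mathbb S_0$, let $x_t^*=\upsilon^*(\mathbb S_{t-1}^* )$, $\mathbb S_t^*=\Phi(x_t^*,\mathbb S_{t-1}^* )$; $u^*=\inf\{t\ge1:\mathbb S_t^*=\mathbb S_\ell^*\text{ for some }0\le\ell<t\}$, $\ell^*\in[0,u^* )$ the integer with $\mathbb S^*_{\ell^*}=\mathbb S^*_{u^*}$; $z_0^*=(x_1^*,\dots,x_{\ell^*}^* )$, $\Xi_1^*=(x^*_{\ell^*+1},\dots,x^*_{u^*})$. Optimal $\Xi_2^*$. Let $r(x,\mathbb S)=I_x+\omega(\Psi(x,\mathbb S))$, and let $\lambda'\in\mathbb R$, $h':[K]^\kappa\to\mathbb R$ solve $\lambda'+h'(\mathbb S)=\max_{x\in[K]}[r(x,\mathbb S)+h'(\Phi(x,\mathbb S))]$ for all $\mathbb S\in[K]^\kappa$; $\upsilon'(\mathbb S)\in\arg\max_x[r(x,\mathbb S)+h'(\Phi(x,\mathbb S))]$. With $\mathbb S_0'=\mathbb S_0$, $x_t'=\upsilon'(\mathbb S_{t-1}')$, $\mathbb S_t'=\Phi(x_t',\mathbb S_{t-1}')$, let $u'=\inf\{t\ge1:\mathbb S_t'=\mathbb S_\ell'\text{ for some }0\le\ell<t\}$, $\ell'\in[0,u')$ with $\mathbb S'_{\ell'}=\mathbb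 S'_{u'}$, and $\Xi_2^*=(x'_{\ell'+1},\dots,x'_{u'})$. Asymptotic notation (limits as $\alpha\to0$): $x=o(y)$ if $x/y\to0$; $x=O(y)$ if $\limsup x/y<\infty$. *)

theory Defs
  imports "HOL-Probability.Probability" "HOL-Library.Landau_Symbols"
begin

text \<open>
  The set of treatments $[K]$ is a finite type \<open>'k\<close> with $K = $ \<open>CARD('k)\<close>.  Memory states in
  $[K]^\kappa$ are lists of length $\kappa$ with the most recent treatment first; treatment histories
  $(x_1,\dots,x_t)$ and blocks are lists in chronological order.  Infinite treatment and response
  sequences are functions on \<open>nat\<close> whose value at 0 is irrelevant.
\<close>

definition omega :: "real \<Rightarrow> real" where
  "omega x = \<bar>ln (1 - x)\<bar>"


section \<open>Finite memory model\<close>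

definition Phi :: "'k \<Rightarrow> 'k list \<Rightarrow> 'k list" where
  "Phi x S = butlast (x # S)"

definition mem_state :: "'k list \<Rightarrow> 'k list \<Rightarrow> 'k list" where
  "mem_state S0 xs = fold Phi xs S0"

text \<open>\<open>cp_prob p0 \<Psi> S0 [x\<^sub>1, \<dots>, x\<^sub>t]\<close> is $\pi_t(x_1,\dots,x_t)$, including $\pi_0$ for $t = 0$.\<close>

definition cp_prob ::
    "real \<Rightarrow> ('k \<Rightarrow> 'k list \<Rightarrow> real) \<Rightarrow> 'k list \<Rightarrow> 'k list \<Rightarrow> real" where
  "cp_prob p0 \<Psi> S0 xs =
     (if xs = [] then p0 else \<Psi> (last xs) (mem_state S0 (butlast xs)))"


section \<open>Response model\<close>

definition info :: "'y measure \<Rightarrow> ('k \<Rightarrow> 'y \<Rightarrow> real) \<Rightarrow> ('k \<Rightarrow> 'y \<Rightarrow> real) \<Rightarrow> 'k \<Rightarrow> real" where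
  "info \<mu> f g x = (\<integral>y. ln (g x y / f x y) * g x y \<partial>\<mu>)"

text \<open>
  With the convention $\log(g/0) = \infty$ for $g > 0$, the integral defining $I_x$ always exists in
  $(-\infty,\infty]$; it is finite iff \<open>info_dom\<close> and \<open>info_integrable\<close> hold.  (The library has
  \<open>ln (g / 0) = 0\<close>, so \<open>info_dom\<close> has to be required separately.)
\<close>

locale response_model =
  fixes \<mu> :: "('y :: polish_space) measure"
    and f g :: "'k :: finite \<Rightarrow> 'y \<Rightarrow> real"
  assumes sets_mu: "sets \<mu> = sets borel"
    and sigma_finite_mu: "sigma_finite_measure \<mu>"
    and f_measurable: "\<And>x. f x \<in> borel_measurable \<mu>"
    and g_measurable: "\<And>x. g x \<in> borel_measurable \<mu>"
    and f_nonneg: "\<And>x y. 0 \<le> f x y"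
    and g_nonneg: "\<And>x y. 0 \<le> g x y"
    and f_density: "\<And>x. (\<integral>\<^sup>+y. ennreal (f x y) \<partial>\<mu>) = 1"
    and g_density: "\<And>x. (\<integral>\<^sup>+y. ennreal (g x y) \<partial>\<mu>) = 1"
    and info_dom: "\<And>x. AE y in \<mu>. 0 < g x y \<longrightarrow> 0 < f x y"
    and info_integrable: "\<And>x. integrable \<mu> (\<lambda>y. ln (g x y / f x y) * g x y)"
    and info_pos: "\<And>x. 0 < info \<mu> f g x"


section \<open>Assignment rules and the controlled change-point process\<close>

text \<open>
  \<open>\<delta> t\<close> maps $((X_1,\dots,X_{t-1}),(Y_1,\dots,Y_{t-1}))$ to $X_t$.  For $t = 1$ the domain is a
  one-point space, so $X_1$ is deterministic.
\<close>

type_synonym ('k, 'y) rule = "nat \<Rightarrow> (nat \<Rightarrow> 'k) \<times> (nat \<Rightarrow> 'y) \<Rightarrow> 'k"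

definition assignment_rule :: "('k, 'y :: topological_space) rule \<Rightarrow> bool" where
  "assignment_rule \<delta> \<longleftrightarrow>
     (\<forall>t\<ge>1. \<delta> t \<in> (PiM {1..<t} (\<lambda>_. count_space UNIV) \<Otimes>\<^sub>M PiM {1..<t} (\<lambda>_. borel))
               \<rightarrow>\<^sub>M count_space UNIV)"

definition latent :: "('w \<Rightarrow> enat) \<Rightarrow> nat \<Rightarrow> 'w \<Rightarrow> bool" where
  "latent \<Theta> t w \<longleftrightarrow> \<Theta> w \<le> enat t"

definition events_of :: "'w measure \<Rightarrow> 'a measure \<Rightarrow> ('w \<Rightarrow> 'a) \<Rightarrow> 'w set set" where
  "events_of M N Z = {Z -` A \<inter> space M |A. A \<in> sets N}"

text \<open>A generator of the $\sigma$-algebra $\mathcal F_t$.\<close>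

definition obs_events ::
    "'w measure \<Rightarrow> (nat \<Rightarrow> 'w \<Rightarrow> 'k) \<Rightarrow> (nat \<Rightarrow> 'w \<Rightarrow> 'y :: topological_space) \<Rightarrow> nat
      \<Rightarrow> 'w set set" where
  "obs_events M X Y t =
     (\<Union>s\<in>{1..t}. events_of M (count_space UNIV) (X s) \<union> events_of M borel (Y s))"

definition treatments :: "(nat \<Rightarrow> 'w \<Rightarrow> 'k) \<Rightarrow> nat \<Rightarrow> 'w \<Rightarrow> 'k list" where
  "treatments X t w = map (\<lambda>s. X s w) [1..<Suc t]"

text \<open>
  \<open>changepoint_process \<mu> f g p0 \<Psi> S0 \<delta> M \<Theta> X Y\<close>: on the probability space \<open>M\<close>, the change-point
  \<open>\<Theta>\<close>, treatments \<open>X\<close> and responses \<open>Y\<close> follow the model under the assignment rule \<open>\<delta>\<close>.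
\<close>

locale changepoint_process = prob_space M
  for \<mu> :: "('y :: polish_space) measure"
    and f g :: "'k :: finite \<Rightarrow> 'y \<Rightarrow> real"
    and p0 :: real
    and \<Psi> :: "'k \<Rightarrow> 'k list \<Rightarrow> real"
    and S0 :: "'k list"
    and \<delta> :: "('k, 'y) rule"
    and M :: "'w measure"
    and \<Theta> :: "'w \<Rightarrow> enat"
    and X :: "nat \<Rightarrow> 'w \<Rightarrow> 'k"
    and Y :: "nat \<Rightarrow> 'w \<Rightarrow> 'y" +
  assumes Theta_rv: "\<Theta> \<in> M \<rightarrow>\<^sub>M count_space UNIV"
    and X_rv: "\<And>t. t \<ge> 1 \<Longrightarrow> X t \<in> M \<rightarrow>\<^sub>M count_space UNIV"
    and Y_rv: "\<And>t. t \<ge> 1 \<Longrightarrow> Y t \<in> M \<rightarrow>\<^sub>M borel"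
    and X_rule: "\<And>t w. t \<ge> 1 \<Longrightarrow> w \<in> space M \<Longrightarrow>
      X t w = \<delta> t (restrict (\<lambda>s. X s w) {1..<t}, restrict (\<lambda>s. Y s w) {1..<t})"
    and initial: "prob {w \<in> space M. latent \<Theta> 0 w} = p0"
    and transition: "\<And>t. t \<ge> 1 \<Longrightarrow>
      AE w in M. \<not> latent \<Theta> (t - 1) w \<longrightarrow>
        real_cond_exp M
          (sigma (space M)
            (obs_events M X Y (t - 1) \<union> events_of M (count_space UNIV) (X t)
              \<union> events_of M (count_space UNIV) (latent \<Theta> (t - 1))))
          (indicator {w \<in> space M. latent \<Theta> t w}) w
        = cp_prob p0 \<Psi> S0 (treatments X t w)"
    and response: "\<And>t B. t \<ge> 1 \<Longrightarrow> B \<in> sets borel \<Longrightarrow>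
      AE w in M.
        real_cond_exp M
          (sigma (space M)
            (obs_events M X Y (t - 1) \<union> events_of M (count_space UNIV) (X t)
              \<union> (\<Union>i\<in>{0..t}. events_of M (count_space UNIV) (latent \<Theta> i))))
          (indicator (Y t -` B \<inter> space M)) w
        = (LINT y:B|\<mu>. (if latent \<Theta> t w then g (X t w) y else f (X t w) y))"


section \<open>Blocks\<close>

text \<open>\<open>cyc \<Xi> i\<close> is $\Xi(i)$ for an arbitrary integer index, blocks being indexed from 1.\<close>

definition cyc :: "'k list \<Rightarrow> int \<Rightarrow> 'k" where
  "cyc \<Xi> i = \<Xi> ! nat ((i - 1) mod int (length \<Xi>))"

definition block_prefix :: "'k list \<Rightarrow> nat \<Rightarrow> 'k list" where
  "block_prefix \<Xi> s = map (\<lambda>i. cyc \<Xi> (int i)) [1..<Suc s]"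

definition I_block :: "('k \<Rightarrow> real) \<Rightarrow> 'k list \<Rightarrow> real" where
  "I_block I \<Xi> = (\<Sum>i=1..length \<Xi>. I (cyc \<Xi> (int i))) / real (length \<Xi>)"

definition d_block :: "nat \<Rightarrow> ('k \<Rightarrow> 'k list \<Rightarrow> real) \<Rightarrow> 'k list \<Rightarrow> real" where
  "d_block \<kappa> \<Psi> \<Xi> =
     (\<Sum>j=1..length \<Xi>.
        omega (\<Psi> (cyc \<Xi> (int j)) (map (\<lambda>i. cyc \<Xi> (int j - int i)) [1..<Suc \<kappa>])))
     / real (length \<Xi>)"

definition D_block ::
    "nat \<Rightarrow> ('k \<Rightarrow> real) \<Rightarrow> ('k \<Rightarrow> 'k list \<Rightarrow> real) \<Rightarrow> 'k list \<Rightarrow> real" where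
  "D_block \<kappa> I \<Psi> \<Xi> = I_block I \<Xi> + d_block \<kappa> \<Psi> \<Xi>"

text \<open>The series below may diverge, so $\widetilde\lambda$, $\lambda$ and $V^*$ take values in
  $[0,\infty]$.  Sums over $t \ge 1$ are written with the index shifted by one.\<close>

definition lambda_tilde ::
    "real \<Rightarrow> ('k \<Rightarrow> 'k list \<Rightarrow> real) \<Rightarrow> 'k list \<Rightarrow> 'k list \<Rightarrow> ennreal" where
  "lambda_tilde p0 \<Psi> S0 \<Xi> =
     (SUP z. 1 + (\<Sum>t. \<Prod>s=1..Suc t. ennreal (1 - cp_prob p0 \<Psi> S0 (z @ block_prefix \<Xi> s))))"

definition lambda_block ::
    "real \<Rightarrow> ('k \<Rightarrow> 'k list \<Rightarrow> real) \<Rightarrow> 'k list \<Rightarrow> 'k list \<Rightarrow> 'k list \<Rightarrow> ennreal" where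
  "lambda_block p0 \<Psi> S0 z0 \<Xi> =
     (let t0 = length z0; q = (\<lambda>xs. ennreal (1 - cp_prob p0 \<Psi> S0 xs)) in
      ennreal (1 - p0) *
        (1 + (\<Sum>t=1..t0. \<Prod>s=1..t. q (take s z0))
           + (\<Sum>t. (\<Prod>s=1..t0. q (take s z0)) *
                  (\<Prod>s=Suc t0..Suc (t0 + t). q (z0 @ block_prefix \<Xi> (s - t0))))))"


section \<open>Optimal blocks\<close>

definition V_opt :: "('k \<Rightarrow> 'k list \<Rightarrow> real) \<Rightarrow> 'k list \<Rightarrow> ennreal" where
  "V_opt \<Psi> S =
     (INF x :: nat \<Rightarrow> 'k.
        (\<Sum>t. \<Prod>s=1..Suc t. ennreal (1 - \<Psi> (x s) (mem_state S (map x [1..<s])))))"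

definition reward ::
    "('k \<Rightarrow> real) \<Rightarrow> ('k \<Rightarrow> 'k list \<Rightarrow> real) \<Rightarrow> 'k \<Rightarrow> 'k list \<Rightarrow> real" where
  "reward I \<Psi> x S = I x + omega (\<Psi> x S)"

definition optimal_delay_policy ::
    "nat \<Rightarrow> ('k \<Rightarrow> 'k list \<Rightarrow> real) \<Rightarrow> ('k list \<Rightarrow> 'k) \<Rightarrow> bool" where
  "optimal_delay_policy \<kappa> \<Psi> \<upsilon> \<longleftrightarrow>
     (\<forall>S. length S = \<kappa> \<longrightarrow>
        is_arg_min (\<lambda>x. ennreal (1 - \<Psi> x S) * (1 + V_opt \<Psi> (Phi x S))) (\<lambda>_. True) (\<upsilon> S))"

definition average_reward_eq ::
    "nat \<Rightarrow> ('k :: finite \<Rightarrow> real) \<Rightarrow> ('k \<Rightarrow> 'k list \<Rightarrow> real) \<Rightarrow> real \<Rightarrow> ('k list \<Rightarrow> real)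
      \<Rightarrow> bool" where
  "average_reward_eq \<kappa> I \<Psi> l h \<longleftrightarrow>
     (\<forall>S. length S = \<kappa> \<longrightarrow> l + h S = (MAX x. reward I \<Psi> x S + h (Phi x S)))"

definition optimal_reward_policy ::
    "nat \<Rightarrow> ('k \<Rightarrow> real) \<Rightarrow> ('k \<Rightarrow> 'k list \<Rightarrow> real) \<Rightarrow> ('k list \<Rightarrow> real) \<Rightarrow> ('k list \<Rightarrow> 'k)
      \<Rightarrow> bool" where
  "optimal_reward_policy \<kappa> I \<Psi> h \<upsilon> \<longleftrightarrow>
     (\<forall>S. length S = \<kappa> \<longrightarrow>
        is_arg_max (\<lambda>x. reward I \<Psi> x S + h (Phi x S)) (\<lambda>_. True) (\<upsilon> S))"

fun policy_state :: "('k list \<Rightarrow> 'k) \<Rightarrow> 'k list \<Rightarrow> nat \<Rightarrow> 'k list" where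
  "policy_state \<upsilon> S0 0 = S0"
| "policy_state \<upsilon> S0 (Suc t) = Phi (\<upsilon> (policy_state \<upsilon> S0 t)) (policy_state \<upsilon> S0 t)"

definition policy_action :: "('k list \<Rightarrow> 'k) \<Rightarrow> 'k list \<Rightarrow> nat \<Rightarrow> 'k" where
  "policy_action \<upsilon> S0 t = \<upsilon> (policy_state \<upsilon> S0 (t - 1))"

definition return_time :: "('k list \<Rightarrow> 'k) \<Rightarrow> 'k list \<Rightarrow> nat" where
  "return_time \<upsilon> S0 = (LEAST t. t \<ge> 1 \<and> (\<exists>l<t. policy_state \<upsilon> S0 t = policy_state \<upsilon> S0 l))"

definition cycle_start :: "('k list \<Rightarrow> 'k) \<Rightarrow> 'k list \<Rightarrow> nat" where
  "cycle_start \<upsilon> S0 =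
     (THE l. l < return_time \<upsilon> S0 \<and>
             policy_state \<upsilon> S0 l = policy_state \<upsilon> S0 (return_time \<upsilon> S0))"

definition policy_init :: "('k list \<Rightarrow> 'k) \<Rightarrow> 'k list \<Rightarrow> 'k list" where
  "policy_init \<upsilon> S0 = map (policy_action \<upsilon> S0) [1..<Suc (cycle_start \<upsilon> S0)]"

definition policy_cycle :: "('k list \<Rightarrow> 'k) \<Rightarrow> 'k list \<Rightarrow> 'k list" where
  "policy_cycle \<upsilon> S0 =
     map (policy_action \<upsilon> S0) [Suc (cycle_start \<upsilon> S0)..<Suc (return_time \<upsilon> S0)]"

end

theory Submission
  imports Defs
begin

text \<open>
  Conditionally on the treatments, survival \<open>\<Theta> > t\<close> is multiplied by \<open>1 - \<Pi>\<^sub>t\<^sub>+\<^sub>1\<close> at each step, so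
  $\mathsf E[\Theta]$ dominates $1 - \pi_0$ times one plus the value of every finite-horizon problem.
  These values increase to \<open>V_opt\<close>, which may be infinite, and the stationary policy greedy for
  \<open>V_opt\<close> attains it deterministically. After \<open>\<kappa>\<close> steps the memory has forgotten its initial state,
  while each step preserves survival with probability at least \<open>c\<close>; as the cycle is entered before
  time $K^\kappa$, $\widetilde\lambda(\Xi_1^*)$ is at most affine in $\lambda^*$.

  The rewards telescope along the cycle of the average reward policy, whence $\mathsf D^* = \lambda'$.
  Over \<open>N\<close> steps any other rule collects at most $N\lambda'$ plus the span of \<open>h'\<close>, and the span is at
  most $\kappa\lambda'$.
\<close>

section \<open>Minimal expected delay\<close>

lemma mem_state_eq_take: "mem_state S xs = take (length S) (rev xs @ S)"
proof (induction xs arbitrary: S)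
  case Nil
  show ?case by (simp add: mem_state_def)
next
  case (Cons x xs)
  have "mem_state S (x # xs) = mem_state (Phi x S) xs"
    by (simp add: mem_state_def)
  also have "\<dots> = take (length S) (rev xs @ take (length S) (x # S))"
    by (simp add: Cons.IH Phi_def butlast_conv_take)
  also have "\<dots> = take (length S) (rev (x # xs) @ S)"
    by (simp add: min_def)
  finally show ?case .
qed

lemma length_Phi [simp]: "length (Phi x S) = length S"
  by (simp add: Phi_def)

lemma length_mem_state [simp]: "length (mem_state S xs) = length S"
  by (simp add: mem_state_eq_take)

lemma mem_state_Nil [simp]: "mem_state S [] = S"
  by (simp add: mem_state_def)

lemma mem_state_Cons: "mem_state S (x # xs) = mem_state (Phi x S) xs"
  by (simp add: mem_state_def)

lemma mem_state_append: "mem_state S (xs @ ys) = mem_state (mem_state S xs) ys"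
  by (simp add: mem_state_def)

lemma mem_state_snoc: "mem_state S (xs @ [x]) = Phi x (mem_state S xs)"
  by (simp add: mem_state_def)

text \<open>After \<open>\<kappa>\<close> treatments no entry of the initial state is left. This
  makes the later bounds uniform over the prefixes \<open>z\<close> in
  \<open>lambda_tilde\<close>.\<close>

lemma mem_state_forget:
  "length S \<le> length xs \<Longrightarrow> mem_state S xs = take (length S) (rev xs)"
  by (simp add: mem_state_eq_take)

text \<open>States list the latest treatment first, so feeding \<open>T\<close> in reverse order
  writes \<open>T\<close> into the memory. As every state is reachable, a bound on
  \<open>cp_prob\<close> from \<open>S0\<close> becomes a bound on \<open>\<Psi>\<close>.\<close>

lemma mem_state_reach: "length T = length S \<Longrightarrow> mem_state S (rev T) = T"
  by (simp add: mem_state_forget)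

lemma cp_prob_snoc [simp]: "cp_prob p0 \<Psi> S0 (xs @ [x]) = \<Psi> x (mem_state S0 xs)"
  by (simp add: cp_prob_def)

section \<open>Delay of a fixed treatment sequence\<close>

lemma map_upt_shift: "m \<ge> 1 \<Longrightarrow> map x [1..<Suc m] = x 1 # map (\<lambda>s. x (Suc s)) [1..<m]"
  by (induction m rule: nat_induct_at_least) auto

text \<open>The objective that \<open>V_opt\<close> minimises, for one sequence. Under a
  deterministic rule the expected change-point is
  \<open>(1 - p0) * (1 + delay_cost \<Psi> S0 x)\<close>.\<close>

definition delay_cost ::
    "('k \<Rightarrow> 'k list \<Rightarrow> real) \<Rightarrow> 'k list \<Rightarrow> (nat \<Rightarrow> 'k) \<Rightarrow> ennreal" where
  "delay_cost \<Psi> S x =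
     (\<Sum>t. \<Prod>s=1..Suc t. ennreal (1 - \<Psi> (x s) (mem_state S (map x [1..<s]))))"

lemma V_opt_le_delay_cost: "V_opt \<Psi> S \<le> delay_cost \<Psi> S x"
  unfolding V_opt_def delay_cost_def by (rule INF_lower) simp

lemma delay_cost_cong:
  assumes "\<And>s. s \<ge> 1 \<Longrightarrow> x s = y s"
  shows "delay_cost \<Psi> S x = delay_cost \<Psi> S y"
proof -
  have m: "map x [1..<s] = map y [1..<s]" for s
    using assms by (intro map_cong) auto
  show ?thesis
    unfolding delay_cost_def m using assms by (intro suminf_cong prod.cong) auto
qed

text \<open>Peeling off the first factor restarts the product in the next state. The right-hand
  product stops at \<open>t\<close>, so it is empty for \<open>t = 0\<close>; this is the source of
  the \<open>1\<close> added to the delay cost of the next state.\<close>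

lemma survival_product_shift:
  "(\<Prod>s=1..Suc t. ennreal (1 - \<Psi> (x s) (mem_state S (map x [1..<s])))) =
   ennreal (1 - \<Psi> (x 1) S) *
     (\<Prod>s=1..t. ennreal (1 - \<Psi> (x (Suc s))
        (mem_state (Phi (x 1) S) (map (\<lambda>s. x (Suc s)) [1..<s]))))"
proof -
  let ?a = "\<lambda>s. ennreal (1 - \<Psi> (x s) (mem_state S (map x [1..<s])))"
  have "(\<Prod>s=1..Suc t. ?a s) = ?a 1 * (\<Prod>s=Suc 1..Suc t. ?a s)"
    by (subst prod.atLeast_Suc_atMost) auto
  also have "(\<Prod>s=Suc 1..Suc t. ?a s) = (\<Prod>s=1..t. ?a (Suc s))"
    by (rule prod.shift_bounds_cl_Suc_ivl)
  also have "\<dots> = (\<Prod>s=1..t. ennreal (1 - \<Psi> (x (Suc s))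
        (mem_state (Phi (x 1) S) (map (\<lambda>s. x (Suc s)) [1..<s]))))"
    by (intro prod.cong refl) (simp only: atLeastAtMost_iff map_upt_shift mem_state_Cons)
  finally show ?thesis by simp
qed

lemma delay_cost_shift:
  "delay_cost \<Psi> S x =
     ennreal (1 - \<Psi> (x 1) S) * (1 + delay_cost \<Psi> (Phi (x 1) S) (\<lambda>s. x (Suc s)))"
proof -
  let ?P = "\<lambda>t. \<Prod>s=1..t. ennreal (1 - \<Psi> (x (Suc s))
        (mem_state (Phi (x 1) S) (map (\<lambda>s. x (Suc s)) [1..<s])))"
  have "delay_cost \<Psi> S x = (\<Sum>t. ennreal (1 - \<Psi> (x 1) S) * ?P t)"
    unfolding delay_cost_def survival_product_shift ..
  also have "\<dots> = ennreal (1 - \<Psi> (x 1) S) * (\<Sum>t. ?P t)"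
    by (rule ennreal_suminf_cmult)
  also have "(\<Sum>t. ?P t) = 1 + (\<Sum>t. ?P (Suc t))"
    using suminf_offset[of ?P 1] by (simp add: add.commute)
  finally show ?thesis unfolding delay_cost_def .
qed

lemma delay_cost_upto_shift:
  "(\<Sum>t<Suc n. \<Prod>s=1..Suc t. ennreal (1 - \<Psi> (x s) (mem_state S (map x [1..<s])))) =
     ennreal (1 - \<Psi> (x 1) S) * (1 + (\<Sum>t<n. \<Prod>s=1..Suc t. ennreal (1 - \<Psi> (x (Suc s))
        (mem_state (Phi (x 1) S) (map (\<lambda>s. x (Suc s)) [1..<s])))))"
proof -
  let ?P = "\<lambda>t. \<Prod>s=1..t. ennreal (1 - \<Psi> (x (Suc s))
        (mem_state (Phi (x 1) S) (map (\<lambda>s. x (Suc s)) [1..<s])))"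
  have "(\<Sum>t<Suc n. \<Prod>s=1..Suc t. ennreal (1 - \<Psi> (x s) (mem_state S (map x [1..<s])))) =
      (\<Sum>t<Suc n. ennreal (1 - \<Psi> (x 1) S) * ?P t)"
    by (intro sum.cong refl survival_product_shift)
  also have "\<dots> = ennreal (1 - \<Psi> (x 1) S) * (?P 0 + (\<Sum>t<n. ?P (Suc t)))"
    unfolding sum_distrib_left[symmetric] by (subst sum.lessThan_Suc_shift) (rule refl)
  also have "?P 0 = 1" by simp
  finally show ?thesis .
qed

section \<open>Trajectories of a stationary policy\<close>

lemma policy_state_shift:
  "policy_state \<upsilon> S (Suc t) = policy_state \<upsilon> (Phi (\<upsilon> S) S) t"
  by (induction t) auto

lemma length_policy_state [simp]: "length (policy_state \<upsilon> S t) = length S"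
  by (induction t) auto

lemma policy_action_1 [simp]: "policy_action \<upsilon> S (Suc 0) = \<upsilon> S"
  by (simp add: policy_action_def)

lemma policy_action_shift:
  "s \<ge> 1 \<Longrightarrow> policy_action \<upsilon> S (Suc s) = policy_action \<upsilon> (Phi (\<upsilon> S) S) s"
  using policy_state_shift[of \<upsilon> S "s - 1"] by (simp add: policy_action_def)

lemma policy_state_eq_mem_state:
  "policy_state \<upsilon> S t = mem_state S (map (policy_action \<upsilon> S) [1..<Suc t])"
  by (induction t) (auto simp: mem_state_snoc policy_action_def)

text \<open>Verification argument: a supersolution \<open>W\<close> dominates every partial sum
  along the policy, by induction on the number of terms. Partial sums are finite objects, so
  \<open>W\<close> may take the value infinity. It is applied to \<open>V_opt\<close> and to the
  limit of the finite-horizon values.\<close>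

lemma delay_cost_greedy_le:
  assumes "\<And>S. length S = \<kappa> \<Longrightarrow>
      ennreal (1 - \<Psi> (\<upsilon> S) S) * (1 + W (Phi (\<upsilon> S) S)) \<le> W S"
    and "length S = \<kappa>"
  shows "delay_cost \<Psi> S (policy_action \<upsilon> S) \<le> W S"
proof -
  have "(\<Sum>t<n. \<Prod>s=1..Suc t. ennreal (1 - \<Psi> (policy_action \<upsilon> S s)
          (mem_state S (map (policy_action \<upsilon> S) [1..<s])))) \<le> W S" for n
    using assms(2)
  proof (induction n arbitrary: S)
    case 0
    show ?case by simp
  next
    case (Suc n)
    let ?T = "Phi (\<upsilon> S) S"
    \<comment> \<open>Without its first treatment the trajectory is that of the same policy started
      in \<open>?T\<close>, which is the form the induction hypothesis expects.\<close>
    have m: "map (\<lambda>s. policy_action \<upsilon> S (Suc s)) [1..<s] = map (policy_action \<upsilon> ?T) [1..<s]" for s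
      by (intro map_cong) (auto simp: policy_action_shift)
    have p: "(\<Prod>s=1..Suc t. ennreal (1 - \<Psi> (policy_action \<upsilon> S (Suc s))
        (mem_state ?T (map (\<lambda>s. policy_action \<upsilon> S (Suc s)) [1..<s])))) =
      (\<Prod>s=1..Suc t. ennreal (1 - \<Psi> (policy_action \<upsilon> ?T s)
        (mem_state ?T (map (policy_action \<upsilon> ?T) [1..<s]))))" for t
      unfolding m by (intro prod.cong) (auto simp: policy_action_shift)
    have "(\<Sum>t<Suc n. \<Prod>s=1..Suc t. ennreal (1 - \<Psi> (policy_action \<upsilon> S s)
          (mem_state S (map (policy_action \<upsilon> S) [1..<s])))) =
        ennreal (1 - \<Psi> (\<upsilon> S) S) * (1 + (\<Sum>t<n. \<Prod>s=1..Suc t.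
          ennreal (1 - \<Psi> (policy_action \<upsilon> ?T s)
            (mem_state ?T (map (policy_action \<upsilon> ?T) [1..<s])))))"
      using delay_cost_upto_shift[of \<Psi> "policy_action \<upsilon> S" S n]
      unfolding p[symmetric] by (simp only: One_nat_def policy_action_1)
    also have "\<dots> \<le> ennreal (1 - \<Psi> (\<upsilon> S) S) * (1 + W ?T)"
      using Suc.IH[of ?T] Suc.prems by (intro mult_left_mono add_left_mono) auto
    also have "\<dots> \<le> W S" using assms(1) Suc.prems .
    finally show ?case .
  qed
  then show ?thesis
    unfolding delay_cost_def suminf_eq_SUP by (intro SUP_least)
qed

text \<open>The tail of any sequence costs at least \<open>V_opt\<close> of the next state. Hence
  \<open>V_opt\<close> is a supersolution for every policy that is greedy with respect to
  it.\<close>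

lemma V_opt_Bellman_ge:
  "(INF x. ennreal (1 - \<Psi> x S) * (1 + V_opt \<Psi> (Phi x S))) \<le> V_opt \<Psi> S"
  unfolding V_opt_def[of \<Psi> S] delay_cost_def[symmetric]
proof (rule INF_greatest)
  fix x :: "nat \<Rightarrow> 'a"
  have "(INF y. ennreal (1 - \<Psi> y S) * (1 + V_opt \<Psi> (Phi y S)))
      \<le> ennreal (1 - \<Psi> (x 1) S) * (1 + V_opt \<Psi> (Phi (x 1) S))"
    by (rule INF_lower) simp
  also have "\<dots> \<le> delay_cost \<Psi> S x"
    unfolding delay_cost_shift[of \<Psi> S x]
    by (intro mult_left_mono add_left_mono V_opt_le_delay_cost) auto
  finally show "(INF y. ennreal (1 - \<Psi> y S) * (1 + V_opt \<Psi> (Phi y S))) \<le> delay_cost \<Psi> S x" .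
qed

lemma delay_cost_optimal_policy:
  assumes "optimal_delay_policy \<kappa> \<Psi> \<upsilon>" "length S = \<kappa>"
  shows "delay_cost \<Psi> S (policy_action \<upsilon> S) = V_opt \<Psi> S"
proof (rule antisym[OF delay_cost_greedy_le[where \<kappa> = \<kappa>] V_opt_le_delay_cost])
  fix S :: "'a list" assume "length S = \<kappa>"
  then have "ennreal (1 - \<Psi> (\<upsilon> S) S) * (1 + V_opt \<Psi> (Phi (\<upsilon> S) S))
      \<le> (INF x. ennreal (1 - \<Psi> x S) * (1 + V_opt \<Psi> (Phi x S)))"
    using assms(1) by (intro INF_greatest)
      (auto simp: optimal_delay_policy_def is_arg_min_linorder)
  then show "ennreal (1 - \<Psi> (\<upsilon> S) S) * (1 + V_opt \<Psi> (Phi (\<upsilon> S) S)) \<le> V_opt \<Psi> S"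
    using V_opt_Bellman_ge order_trans by blast
qed fact

section \<open>Finite horizons\<close>

text \<open>Backward dynamic programming for the delay series cut after \<open>n\<close> terms.
  Unlike \<open>V_opt\<close>, an infimum over fixed sequences, it can be compared with adaptive
  rules by induction on \<open>n\<close>.\<close>

primrec horizon_value ::
    "('k \<Rightarrow> 'k list \<Rightarrow> real) \<Rightarrow> nat \<Rightarrow> 'k list \<Rightarrow> ennreal" where
  "horizon_value \<Psi> 0 S = 0"
| "horizon_value \<Psi> (Suc n) S =
     (INF x. ennreal (1 - \<Psi> x S) * (1 + horizon_value \<Psi> n (Phi x S)))"

lemma horizon_value_incseq: "incseq (\<lambda>n. horizon_value \<Psi> n S)"
proof (rule incseq_SucI)
  show "horizon_value \<Psi> n S \<le> horizon_value \<Psi> (Suc n) S" for n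
  proof (induction n arbitrary: S)
    case (Suc n)
    show ?case
      unfolding horizon_value.simps(2)[of _ "Suc n"] horizon_value.simps(2)[of _ n S]
      by (intro INF_mono' mult_left_mono add_left_mono Suc.IH) auto
  qed simp
qed

text \<open>With finitely many treatments one of them is optimal for infinitely many horizons, and it
  remains optimal in the limit. This avoids any boundedness assumption on the value function.\<close>

lemma SUP_horizon_value_Bellman:
  fixes \<Psi> :: "'k :: finite \<Rightarrow> 'k list \<Rightarrow> real"
  shows "\<exists>x. ennreal (1 - \<Psi> x S) * (1 + (SUP n. horizon_value \<Psi> n (Phi x S)))
           \<le> (SUP n. horizon_value \<Psi> n S)"
proof -
  let ?F = "\<lambda>n x. ennreal (1 - \<Psi> x S) * (1 + horizon_value \<Psi> n (Phi x S))"
  have "\<exists>x. ?F n x = horizon_value \<Psi> (Suc n) S" for n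
  proof -
    have "Inf (range (?F n)) \<in> range (?F n)"
      by (subst cInf_eq_Min) (auto intro!: Min_in simp del: Min_in)
    then show ?thesis unfolding horizon_value.simps(2) by fastforce
  qed
  then have "\<forall>n. \<exists>x. ?F n x = horizon_value \<Psi> (Suc n) S" by blast
  from choice[OF this] obtain \<xi> where \<xi>: "?F n (\<xi> n) = horizon_value \<Psi> (Suc n) S" for n
    by blast
  obtain x where "infinite {n. \<xi> n = x}"
    using pigeonhole_infinite[of "UNIV :: nat set" \<xi>] by auto
  then have ex: "\<exists>m\<ge>n. \<xi> m = x" for n
    by (metis (mono_tags, lifting) infinite_nat_iff_unbounded_le mem_Collect_eq)
  \<comment> \<open>A horizon at which \<open>x\<close> is not the chosen minimiser is dominated by
    a later one at which it is, since horizon values increase.\<close>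
  have le: "?F n x \<le> (SUP n. horizon_value \<Psi> n S)" for n
  proof -
    obtain m where m: "m \<ge> n" "\<xi> m = x" using ex by blast
    have "?F n x \<le> ?F m x"
      using incseqD[OF horizon_value_incseq m(1)] by (intro mult_left_mono add_left_mono) auto
    also have "\<dots> = horizon_value \<Psi> (Suc m) S" using \<xi>[of m] m(2) by simp
    also have "\<dots> \<le> (SUP n. horizon_value \<Psi> n S)" by (rule SUP_upper) simp
    finally show ?thesis .
  qed
  have "ennreal (1 - \<Psi> x S) * (1 + (SUP n. horizon_value \<Psi> n (Phi x S))) = (SUP n. ?F n x)"
    by (simp add: SUP_mult_left_ennreal ennreal_SUP_add_right)
  also have "\<dots> \<le> (SUP n. horizon_value \<Psi> n S)"
    by (intro SUP_least le)
  finally show ?thesis ..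
qed

text \<open>Selecting in each state the treatment of the previous lemma gives a policy for which the
  limit of the horizon values is a supersolution; its delay cost lies between \<open>V_opt\<close>
  and that limit.\<close>

lemma V_opt_le_SUP_horizon_value:
  fixes \<Psi> :: "'k :: finite \<Rightarrow> 'k list \<Rightarrow> real"
  shows "V_opt \<Psi> S \<le> (SUP n. horizon_value \<Psi> n S)"
proof -
  let ?W = "\<lambda>S. SUP n. horizon_value \<Psi> n S"
  have "\<forall>S. \<exists>x. ennreal (1 - \<Psi> x S) * (1 + ?W (Phi x S)) \<le> ?W S"
    using SUP_horizon_value_Bellman by blast
  from choice[OF this] obtain \<upsilon>
    where \<upsilon>: "ennreal (1 - \<Psi> (\<upsilon> S) S) * (1 + ?W (Phi (\<upsilon> S) S)) \<le> ?W S" for S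
    by blast
  have "delay_cost \<Psi> S (policy_action \<upsilon> S) \<le> ?W S"
    by (rule delay_cost_greedy_le[where \<kappa> = "length S"]) (rule \<upsilon>, rule refl)
  with V_opt_le_delay_cost show ?thesis by (rule order_trans)
qed

section \<open>Expected change-point under an assignment rule\<close>

lemma vimage_in_events_of: "A \<in> sets N \<Longrightarrow> Z -` A \<inter> space M \<in> events_of M N Z"
  unfolding events_of_def by (rule CollectI) (rule exI, rule conjI[OF refl])

context changepoint_process
begin

section \<open>Survival given the treatment history\<close>

lemma Theta_set [measurable]: "{w \<in> space M. P (\<Theta> w)} \<in> events"
  using measurable_sets[OF Theta_rv, of "{x. P x}"]
  by (simp add: vimage_def Int_def conj_commute)

text \<open>Turns an event about the whole history into a finite conjunction over single treatments,
  so that measurability can be checked coordinatewise, both in \<open>M\<close> and in the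
  conditioning sigma-algebra.\<close>

lemma treatments_eq_iff:
  "length xs = t \<Longrightarrow> treatments X t w = xs \<longleftrightarrow> (\<forall>s\<in>{1..t}. X s w = xs ! (s - 1))"
proof (induction t arbitrary: xs)
  case (Suc t)
  then obtain ys y where xs: "xs = ys @ [y]" "length ys = t"
    by (metis append_butlast_last_id length_append_singleton length_0_conv nat.distinct(1) nat.inject)
  have "treatments X (Suc t) w = xs \<longleftrightarrow> treatments X t w = ys \<and> X (Suc t) w = y"
    by (simp add: treatments_def xs)
  also have "\<dots> \<longleftrightarrow> (\<forall>s\<in>{1..Suc t}. X s w = xs ! (s - 1))"
  proof -
    have *: "{1..Suc t} = insert (Suc t) {1..t}" by auto
    show ?thesis
      unfolding Suc.IH[OF xs(2)] * using xs(2) by (auto simp: xs(1) nth_append)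
  qed
  finally show ?case .
qed (simp add: treatments_def)

lemma treatments_set [measurable]: "{w \<in> space M. treatments X t w = xs} \<in> events"
proof (cases "length xs = t")
  case True
  have "{w \<in> space M. X s w = x} \<in> events" if "s \<in> {1..t}" for s x
    using measurable_sets[OF X_rv, of s "{x}"] that
    by (simp add: vimage_def Int_def conj_commute)
  then show ?thesis
    unfolding treatments_eq_iff[OF True] by (intro sets.sets_Collect_finite_All) auto
next
  case False
  then have "{w \<in> space M. treatments X t w = xs} = {}"
    by (auto simp: treatments_def)
  then show ?thesis by (simp only: sets.empty_sets)
qed

text \<open>The transition identity is integrated over the event that the history is
  \<open>xs\<close> and no change has occurred by time \<open>t\<close>. This event belongs to the
  conditioning sigma-algebra, and on it the conditional probability of a change is constant.\<close>

lemma survival_step: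
  assumes "length xs = Suc t"
  shows "prob {w \<in> space M. treatments X (Suc t) w = xs \<and> enat (Suc t) < \<Theta> w} =
    (1 - cp_prob p0 \<Psi> S0 xs) * prob {w \<in> space M. treatments X (Suc t) w = xs \<and> enat t < \<Theta> w}"
proof -
  let ?gen = "obs_events M X Y t \<union> events_of M (count_space UNIV) (X (Suc t))
              \<union> events_of M (count_space UNIV) (latent \<Theta> t)"
  define G where "G = sigma (space M) ?gen"
  let ?B = "{w \<in> space M. treatments X (Suc t) w = xs \<and> enat t < \<Theta> w}"
  let ?L = "{w \<in> space M. latent \<Theta> (Suc t) w}"
  have latent_rv: "latent \<Theta> t \<in> M \<rightarrow>\<^sub>M count_space UNIV"
    unfolding latent_def[abs_def] using Theta_rv by (rule measurable_compose) simp
  have gen: "?gen \<subseteq> events"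
    unfolding obs_events_def events_of_def
    by (intro Un_least UN_least) (auto intro!: measurable_sets[OF latent_rv]
      measurable_sets[OF X_rv] measurable_sets[OF Y_rv])
  then have gen_Pow: "?gen \<subseteq> Pow (space M)"
    using sets.space_closed by (rule order_trans)
  have space_G: "space G = space M" and sets_G: "sets G = sigma_sets (space M) ?gen"
    unfolding G_def using gen_Pow by (auto simp: space_measure_of_conv sets_measure_of)
  have "subalgebra M G"
    unfolding subalgebra_def space_G sets_G using gen by (simp add: sets.sigma_sets_subset)
  then interpret G: finite_measure_subalgebra M G
    by unfold_locales
  have X_G: "{w \<in> space G. X s w = x} \<in> sets G" if "s \<in> {1..Suc t}" for s x
  proof -
    have "{w \<in> space G. X s w = x} \<in> events_of M (count_space UNIV) (X s)"
      unfolding events_of_def space_G by (auto intro!: exI[of _ "{x}"])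
    moreover have "events_of M (count_space UNIV) (X s) \<subseteq> ?gen"
    proof (cases "s = Suc t")
      case False
      then have "s \<in> {1..t}" using that by auto
      then show ?thesis unfolding obs_events_def by blast
    qed blast
    ultimately show ?thesis unfolding sets_G by (intro sigma_sets.Basic) (rule subsetD)
  qed
  have "{w \<in> space G. enat t < \<Theta> w} = latent \<Theta> t -` {False} \<inter> space M"
    unfolding space_G latent_def vimage_def by (simp only: not_le[symmetric]) blast
  then have "{w \<in> space G. enat t < \<Theta> w} \<in> events_of M (count_space UNIV) (latent \<Theta> t)"
    by (simp only:) (rule vimage_in_events_of, simp)
  then have "{w \<in> space G. enat t < \<Theta> w} \<in> sets G"
    unfolding sets_G by (intro sigma_sets.Basic UnI2)
  moreover have "{w \<in> space G. \<forall>s\<in>{1..Suc t}. X s w = xs ! (s - 1)} \<in> sets G"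
    by (intro sets.sets_Collect_finite_All X_G) auto
  ultimately have "{w \<in> space G. (\<forall>s\<in>{1..Suc t}. X s w = xs ! (s - 1)) \<and> enat t < \<Theta> w} \<in> sets G"
    by (intro sets.sets_Collect_conj)
  then have B_G: "?B \<in> sets G"
    unfolding treatments_eq_iff[OF assms] space_G .
  have B_M: "?B \<in> events" and L_M: "?L \<in> events"
    by (simp_all add: latent_def)
  have "prob (?B \<inter> ?L) = (LINT w:?B|M. indicator ?L w)"
    using B_M L_M by (simp add: set_lebesgue_integral_def flip: indicator_inter_arith)
  \<comment> \<open>The defining property of conditional expectation, available because
    \<open>?B\<close> lies in \<open>G\<close>.\<close>
  also have "\<dots> = (LINT w:?B|M. real_cond_exp M G (indicator ?L) w)"
    using L_M B_G by (intro G.real_cond_exp_intA) (auto simp: integrable_indicator_iff less_top[symmetric])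
  \<comment> \<open>The model prescribes the conditional probability only before the change;
    \<open>?B\<close> is contained in that region.\<close>
  also have "\<dots> = (LINT w:?B|M. cp_prob p0 \<Psi> S0 xs)"
  proof (rule set_lebesgue_integral_cong_AE)
    have "AE w in M. \<not> latent \<Theta> t w \<longrightarrow>
        real_cond_exp M G (indicator ?L) w = cp_prob p0 \<Psi> S0 (treatments X (Suc t) w)"
      using transition[of "Suc t"] unfolding diff_Suc_1 G_def[symmetric] by simp
    then show "AE w\<in>?B in M. real_cond_exp M G (indicator ?L) w = cp_prob p0 \<Psi> S0 xs"
      by eventually_elim (simp add: latent_def not_le)
  qed (use B_M in auto)
  also have "\<dots> = cp_prob p0 \<Psi> S0 xs * prob ?B"
    using B_M by (simp add: set_lebesgue_integral_def)
  finally have "prob (?B - ?L) = (1 - cp_prob p0 \<Psi> S0 xs) * prob ?B"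
    using finite_measure_Diff'[OF B_M L_M] by (simp add: algebra_simps)
  moreover have "?B - ?L = {w \<in> space M. treatments X (Suc t) w = xs \<and> enat (Suc t) < \<Theta> w}"
    by (auto simp: latent_def not_le intro: less_trans[of "enat t" "enat (Suc t)"])
  ultimately show ?thesis by simp
qed

lemma finite_histories: "finite {xs :: 'k list. length xs = t}"
  using finite_lists_length_eq[of "UNIV :: 'k set" t] by simp

text \<open>Only finitely many histories of length \<open>t\<close> exist, so the integrand is a
  finite sum of indicators. The indices \<open>n\<close> and \<open>t\<close> are separate because
  \<open>survival_step\<close> pairs survival past \<open>t\<close> with a history of length
  \<open>Suc t\<close>.\<close>

lemma nn_integral_history:
  "(\<integral>\<^sup>+w. indicator {w \<in> space M. enat n < \<Theta> w} w * \<phi> (treatments X t w) \<partial>M) =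
   (\<Sum>xs | length xs = t. \<phi> xs * emeasure M {w \<in> space M. treatments X t w = xs \<and> enat n < \<Theta> w})"
proof -
  have "(\<integral>\<^sup>+w. indicator {w \<in> space M. enat n < \<Theta> w} w * \<phi> (treatments X t w) \<partial>M) =
    (\<integral>\<^sup>+w. (\<Sum>xs | length xs = t.
       \<phi> xs * indicator {w \<in> space M. treatments X t w = xs \<and> enat n < \<Theta> w} w) \<partial>M)"
  proof (rule nn_integral_cong)
    fix w assume "w \<in> space M"
    have "(\<Sum>xs | length xs = t.
       \<phi> xs * indicator {w \<in> space M. treatments X t w = xs \<and> enat n < \<Theta> w} w) =
      (\<Sum>xs\<in>{treatments X t w}.
       \<phi> xs * indicator {w \<in> space M. treatments X t w = xs \<and> enat n < \<Theta> w} w)"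
      by (rule sum.mono_neutral_right[OF finite_histories]) (auto simp: treatments_def)
    then show "indicator {w \<in> space M. enat n < \<Theta> w} w * \<phi> (treatments X t w) =
      (\<Sum>xs | length xs = t.
       \<phi> xs * indicator {w \<in> space M. treatments X t w = xs \<and> enat n < \<Theta> w} w)"
      by (simp add: indicator_def)
  qed
  also have "\<dots> = (\<Sum>xs | length xs = t.
      \<phi> xs * emeasure M {w \<in> space M. treatments X t w = xs \<and> enat n < \<Theta> w})"
    by (subst nn_integral_sum) (auto intro!: sum.cong nn_integral_cmult_indicator)
  finally show ?thesis .
qed

lemma survival_integral_step:
  assumes "\<And>xs. cp_prob p0 \<Psi> S0 xs \<le> 1"
  shows "(\<integral>\<^sup>+w. indicator {w \<in> space M. enat (Suc t) < \<Theta> w} w * \<phi> (treatments X (Suc t) w) \<partial>M) =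
    (\<integral>\<^sup>+w. indicator {w \<in> space M. enat t < \<Theta> w} w *
       (ennreal (1 - cp_prob p0 \<Psi> S0 (treatments X (Suc t) w)) * \<phi> (treatments X (Suc t) w)) \<partial>M)"
proof -
  have "emeasure M {w \<in> space M. treatments X (Suc t) w = xs \<and> enat (Suc t) < \<Theta> w} =
      ennreal (1 - cp_prob p0 \<Psi> S0 xs) *
      emeasure M {w \<in> space M. treatments X (Suc t) w = xs \<and> enat t < \<Theta> w}"
    if "length xs = Suc t" for xs
    unfolding emeasure_eq_measure survival_step[OF that]
    using assms[of xs] by (intro ennreal_mult) auto
  then show ?thesis
    unfolding nn_integral_history
      nn_integral_history[where \<phi> = "\<lambda>xs. ennreal (1 - cp_prob p0 \<Psi> S0 xs) * \<phi> xs"]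
    by (intro sum.cong) (auto simp: mult_ac)
qed

lemma treatments_Suc: "treatments X (Suc t) w = treatments X t w @ [X (Suc t) w]"
  by (simp add: treatments_def)

lemma emeasure_survival_0: "emeasure M {w \<in> space M. enat 0 < \<Theta> w} = ennreal (1 - p0)"
proof -
  have "{w \<in> space M. enat 0 < \<Theta> w} = space M - {w \<in> space M. latent \<Theta> 0 w}"
    by (auto simp: latent_def not_le)
  moreover have "{w \<in> space M. latent \<Theta> 0 w} \<in> events"
    by (simp add: latent_def)
  ultimately show ?thesis
    using initial by (simp add: emeasure_eq_measure prob_compl)
qed

section \<open>Bounds on the expected change-point\<close>

text \<open>Dynamic programming against an adaptive rule: the treatment actually chosen is one
  candidate in the infimum, and the survival step absorbs its factor into the event of surviving one
  step longer.\<close>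

lemma survival_sum_ge_horizon_value:
  assumes "\<And>xs. cp_prob p0 \<Psi> S0 xs \<le> 1"
  shows "(\<integral>\<^sup>+w. indicator {w \<in> space M. enat t < \<Theta> w} w *
            horizon_value \<Psi> n (mem_state S0 (treatments X t w)) \<partial>M)
    \<le> (\<Sum>j<n. emeasure M {w \<in> space M. enat (t + Suc j) < \<Theta> w})"
proof (induction n arbitrary: t)
  case 0
  show ?case by simp
next
  case (Suc n)
  let ?E = "\<lambda>t. {w \<in> space M. enat t < \<Theta> w}"
  let ?S = "\<lambda>t w. mem_state S0 (treatments X t w)"
  have "(\<integral>\<^sup>+w. indicator (?E t) w * horizon_value \<Psi> (Suc n) (?S t w) \<partial>M)
      \<le> (\<integral>\<^sup>+w. indicator (?E t) w * (ennreal (1 - cp_prob p0 \<Psi> S0 (treatments X (Suc t) w)) *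
           (1 + horizon_value \<Psi> n (?S (Suc t) w))) \<partial>M)"
  proof (intro nn_integral_mono mult_left_mono)
    fix w
    show "horizon_value \<Psi> (Suc n) (?S t w)
      \<le> ennreal (1 - cp_prob p0 \<Psi> S0 (treatments X (Suc t) w)) *
           (1 + horizon_value \<Psi> n (?S (Suc t) w))"
      unfolding treatments_Suc mem_state_snoc cp_prob_snoc horizon_value.simps(2)
      by (rule INF_lower) simp
  qed simp
  also have "\<dots> = (\<integral>\<^sup>+w. indicator (?E (Suc t)) w * (1 + horizon_value \<Psi> n (?S (Suc t) w)) \<partial>M)"
    using survival_integral_step[OF assms, of t "\<lambda>xs. 1 + horizon_value \<Psi> n (mem_state S0 xs)"] by simp
  \<comment> \<open>Expanding over histories lets the two summands be separated by finite-sum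
    algebra.\<close>
  also have "\<dots> = (\<Sum>xs | length xs = Suc t. (1 + horizon_value \<Psi> n (mem_state S0 xs)) *
      emeasure M {w \<in> space M. treatments X (Suc t) w = xs \<and> enat (Suc t) < \<Theta> w})"
    by (rule nn_integral_history)
  also have "\<dots> = (\<integral>\<^sup>+w. indicator (?E (Suc t)) w * 1 \<partial>M) +
      (\<integral>\<^sup>+w. indicator (?E (Suc t)) w * horizon_value \<Psi> n (?S (Suc t) w) \<partial>M)"
    unfolding nn_integral_history[of _ "\<lambda>xs. horizon_value \<Psi> n (mem_state S0 xs)"]
      nn_integral_history[of _ "\<lambda>_. 1" "Suc t"]
    by (simp add: distrib_right sum.distrib)
  also have "\<dots> \<le> emeasure M (?E (Suc t)) + (\<Sum>j<n. emeasure M (?E (Suc t + Suc j)))"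
    by (intro add_mono Suc.IH) simp
  also have "\<dots> = (\<Sum>j<Suc n. emeasure M (?E (t + Suc j)))"
    by (subst sum.lessThan_Suc_shift) simp
  finally show ?case .
qed

text \<open>The expectation is the sum of the survival probabilities. The term at time 0 is
  \<open>1 - p0\<close>, and the others dominate each finite-horizon value, hence their limit and
  \<open>V_opt\<close>.\<close>

lemma expected_changepoint_ge:
  assumes "\<And>xs. cp_prob p0 \<Psi> S0 xs \<le> 1"
  shows "ennreal (1 - p0) * (1 + V_opt \<Psi> S0) \<le> (\<integral>\<^sup>+w. ennreal_of_enat (\<Theta> w) \<partial>M)"
proof -
  let ?E = "\<lambda>t. {w \<in> space M. enat t < \<Theta> w}"
  have "ennreal (1 - p0) * horizon_value \<Psi> n S0 \<le> (\<Sum>t. emeasure M (?E (Suc t)))" for n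
  proof -
    have "ennreal (1 - p0) * horizon_value \<Psi> n S0 =
        (\<integral>\<^sup>+w. indicator (?E 0) w * horizon_value \<Psi> n (mem_state S0 (treatments X 0 w)) \<partial>M)"
      by (simp add: treatments_def nn_integral_multc emeasure_survival_0)
    also have "\<dots> \<le> (\<Sum>t<n. emeasure M (?E (Suc t)))"
      using survival_sum_ge_horizon_value[OF assms, of 0 n] by simp
    also have "\<dots> \<le> (\<Sum>t. emeasure M (?E (Suc t)))"
      by (rule sum_le_suminf) auto
    finally show ?thesis .
  qed
  then have "ennreal (1 - p0) * (SUP n. horizon_value \<Psi> n S0) \<le> (\<Sum>t. emeasure M (?E (Suc t)))"
    unfolding SUP_mult_left_ennreal by (rule SUP_least)
  with mult_left_mono[OF V_opt_le_SUP_horizon_value zero_le]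
  have "ennreal (1 - p0) * V_opt \<Psi> S0 \<le> (\<Sum>t. emeasure M (?E (Suc t)))"
    by (rule order_trans)
  then have "ennreal (1 - p0) * (1 + V_opt \<Psi> S0) \<le> emeasure M (?E 0) + (\<Sum>t. emeasure M (?E (Suc t)))"
    unfolding emeasure_survival_0 by (simp add: distrib_left add_left_mono)
  also have "\<dots> = (\<Sum>t. emeasure M (?E t))"
    using suminf_offset[of "\<lambda>t. emeasure M (?E t)" 1] by (simp add: add.commute)
  finally show ?thesis
    unfolding nn_integral_enat_function[OF Theta_rv] .
qed

text \<open>With the treatments fixed the survival step has nothing to minimise: survival
  probabilities are products along \<open>x\<close>, and the tail sum is an equality.\<close>

lemma expected_changepoint_deterministic:
  assumes "\<And>xs. cp_prob p0 \<Psi> S0 xs \<le> 1"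
    and "\<And>t w. t \<ge> 1 \<Longrightarrow> w \<in> space M \<Longrightarrow> X t w = x t"
  shows "(\<integral>\<^sup>+w. ennreal_of_enat (\<Theta> w) \<partial>M) = ennreal (1 - p0) * (1 + delay_cost \<Psi> S0 x)"
proof -
  let ?E = "\<lambda>t. {w \<in> space M. enat t < \<Theta> w}"
  let ?a = "\<lambda>s. ennreal (1 - \<Psi> (x s) (mem_state S0 (map x [1..<s])))"
  have tr: "treatments X t w = map x [1..<Suc t]" if "w \<in> space M" for t w
    unfolding treatments_def using that assms(2) by (intro map_cong) auto
  have *: "emeasure M (?E t) = ennreal (1 - p0) * (\<Prod>s=1..t. ?a s)" for t
  proof (induction t)
    case 0
    show ?case by (simp add: emeasure_survival_0)
  next
    case (Suc t)
    have "emeasure M (?E (Suc t)) = (\<integral>\<^sup>+w. indicator (?E (Suc t)) w * 1 \<partial>M)"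
      by simp
    also have "\<dots> = (\<integral>\<^sup>+w. indicator (?E t) w *
        (ennreal (1 - cp_prob p0 \<Psi> S0 (treatments X (Suc t) w)) * 1) \<partial>M)"
      using survival_integral_step[OF assms(1), of t "\<lambda>_. 1"] by simp
    also have "\<dots> = (\<integral>\<^sup>+w. indicator (?E t) w * ?a (Suc t) \<partial>M)"
      by (intro nn_integral_cong) (simp add: treatments_Suc tr assms(2) del: upt_Suc)
    also have "\<dots> = emeasure M (?E t) * ?a (Suc t)"
      by (subst nn_integral_multc) auto
    finally show ?case unfolding Suc.IH by (simp add: mult.assoc)
  qed
  have "(\<integral>\<^sup>+w. ennreal_of_enat (\<Theta> w) \<partial>M) = (\<Sum>t. emeasure M (?E t))"
    by (rule nn_integral_enat_function[OF Theta_rv])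
  also have "\<dots> = ennreal (1 - p0) * (\<Sum>t. \<Prod>s=1..t. ?a s)"
    unfolding * by (rule ennreal_suminf_cmult)
  also have "(\<Sum>t. \<Prod>s=1..t. ?a s) = 1 + (\<Sum>t. \<Prod>s=1..Suc t. ?a s)"
    using suminf_offset[of "\<lambda>t. \<Prod>s=1..t. ?a s" 1] by (simp add: add.commute)
  finally show ?thesis unfolding delay_cost_def .
qed

end

section \<open>Cycles of stationary policies\<close>

lemma policy_state_add:
  "policy_state \<upsilon> S (a + b) = policy_state \<upsilon> (policy_state \<upsilon> S a) b"
  by (induction b) auto

lemma policy_state_period:
  assumes "policy_state \<upsilon> T p = T"
  shows "policy_state \<upsilon> T (n * p + k) = policy_state \<upsilon> T k"
  using assms by (induction n) (simp_all add: policy_state_add add.assoc)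

text \<open>Pigeonhole among the states of length \<open>length S\<close>. The explicit bound later
  keeps the exponent of \<open>c\<close> independent of \<open>\<alpha>\<close>.\<close>

lemma return_time_exists:
  fixes \<upsilon> :: "'k :: finite list \<Rightarrow> 'k"
  shows "\<exists>t\<le>CARD('k) ^ length S. t \<ge> 1 \<and> (\<exists>l<t. policy_state \<upsilon> S t = policy_state \<upsilon> S l)"
proof -
  let ?L = "{xs :: 'k list. length xs = length S}"
  have L: "finite ?L" "card ?L = CARD('k) ^ length S"
    using finite_lists_length_eq[of "UNIV :: 'k set" "length S"]
      card_lists_length_eq[of "UNIV :: 'k set" "length S"] by auto
  have "\<not> inj_on (policy_state \<upsilon> S) {..CARD('k) ^ length S}"
  proof
    assume "inj_on (policy_state \<upsilon> S) {..CARD('k) ^ length S}"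
    then have "card {..CARD('k) ^ length S} \<le> card ?L"
      by (rule card_inj_on_le) (use L(1) in auto)
    then show False using L(2) by simp
  qed
  then obtain i j where "i \<le> CARD('k) ^ length S" "j \<le> CARD('k) ^ length S" "i \<noteq> j"
      "policy_state \<upsilon> S i = policy_state \<upsilon> S j"
    by (auto simp: inj_on_def)
  moreover have "\<exists>t\<le>CARD('k) ^ length S. t \<ge> 1 \<and> (\<exists>l<t. policy_state \<upsilon> S t = policy_state \<upsilon> S l)"
    if "a < b" "b \<le> CARD('k) ^ length S" "policy_state \<upsilon> S b = policy_state \<upsilon> S a" for a b
    using that by (intro exI[of _ b]) auto
  ultimately show ?thesis by (metis linorder_neqE_nat)
qed

lemma return_time_props:
  fixes \<upsilon> :: "'k :: finite list \<Rightarrow> 'k"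
  shows "cycle_start \<upsilon> S < return_time \<upsilon> S"
    and "policy_state \<upsilon> S (cycle_start \<upsilon> S) = policy_state \<upsilon> S (return_time \<upsilon> S)"
    and "return_time \<upsilon> S \<le> CARD('k) ^ length S"
proof -
  let ?Q = "\<lambda>t. t \<ge> 1 \<and> (\<exists>l<t. policy_state \<upsilon> S t = policy_state \<upsilon> S l)"
  let ?u = "return_time \<upsilon> S"
  obtain t where t: "t \<le> CARD('k) ^ length S" "?Q t"
    using return_time_exists[of S \<upsilon>] by blast
  have u: "?Q ?u" unfolding return_time_def by (rule LeastI[of ?Q, OF t(2)])
  have "?u \<le> t" unfolding return_time_def by (rule Least_le[of ?Q, OF t(2)])
  then show "?u \<le> CARD('k) ^ length S" using t(1) by simp
  have no: "\<not> ?Q t" if "t < ?u" for t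
    using that unfolding return_time_def by (rule not_less_Least)
  have "\<exists>!l. l < ?u \<and> policy_state \<upsilon> S l = policy_state \<upsilon> S ?u"
  proof (rule ex_ex1I)
    show "\<exists>l. l < ?u \<and> policy_state \<upsilon> S l = policy_state \<upsilon> S ?u" using u by metis
    fix a b
    assume a: "a < ?u \<and> policy_state \<upsilon> S a = policy_state \<upsilon> S ?u"
      and b: "b < ?u \<and> policy_state \<upsilon> S b = policy_state \<upsilon> S ?u"
    \<comment> \<open>Otherwise \<open>b\<close> would already be a repetition time, against the
      minimality of the return time.\<close>
    have "\<not> a < b" using no[of b] a b by auto
    moreover have "\<not> b < a" using no[of a] a b by auto
    ultimately show "a = b" by simp
  qed
  from theI'[OF this] show "cycle_start \<upsilon> S < ?u"
    and "policy_state \<upsilon> S (cycle_start \<upsilon> S) = policy_state \<upsilon> S ?u"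
    unfolding cycle_start_def[symmetric] by auto
qed

lemma length_policy_cycle:
  "length (policy_cycle \<upsilon> S) = return_time \<upsilon> S - cycle_start \<upsilon> S"
  by (simp add: policy_cycle_def del: upt_Suc)

lemma length_policy_cycle_pos:
  fixes \<upsilon> :: "'k :: finite list \<Rightarrow> 'k"
  shows "0 < length (policy_cycle \<upsilon> S)"
  unfolding length_policy_cycle using return_time_props(1)[of \<upsilon> S] by simp

lemma policy_state_cycle:
  fixes \<upsilon> :: "'k :: finite list \<Rightarrow> 'k"
  shows "policy_state \<upsilon> S (cycle_start \<upsilon> S + (n * length (policy_cycle \<upsilon> S) + k)) =
    policy_state \<upsilon> S (cycle_start \<upsilon> S + k)"
proof -
  have "policy_state \<upsilon> S (cycle_start \<upsilon> S + length (policy_cycle \<upsilon> S)) =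
      policy_state \<upsilon> S (cycle_start \<upsilon> S)"
    using return_time_props(1,2)[of \<upsilon> S] by (simp add: length_policy_cycle)
  then show ?thesis
    unfolding policy_state_add[of _ _ "cycle_start \<upsilon> S"] by (rule policy_state_period)
qed

lemma cyc_periodic: "cyc \<Xi> (i + int n * int (length \<Xi>)) = cyc \<Xi> i"
proof -
  have "(i + int n * int (length \<Xi>) - 1) mod int (length \<Xi>) =
      (i - 1 + int n * int (length \<Xi>)) mod int (length \<Xi>)"
    by (simp add: algebra_simps)
  then show ?thesis by (simp add: cyc_def)
qed

text \<open>The state at the end of the block is the state at its start, so repeating the block
  cyclically continues the trajectory of the policy forever.\<close>

lemma cyc_policy_cycle:
  fixes \<upsilon> :: "'k :: finite list \<Rightarrow> 'k"
  assumes "i \<ge> 1"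
  shows "cyc (policy_cycle \<upsilon> S) (int i) = policy_action \<upsilon> S (cycle_start \<upsilon> S + i)"
proof -
  let ?l = "cycle_start \<upsilon> S" and ?p = "length (policy_cycle \<upsilon> S)"
  have lt: "(i - 1) mod ?p < ?p"
    using length_policy_cycle_pos[of \<upsilon> S] by simp
  have "(int i - 1) mod int ?p = int ((i - 1) mod ?p)"
    using assms by (simp add: of_nat_diff zmod_int)
  then have "cyc (policy_cycle \<upsilon> S) (int i) = policy_cycle \<upsilon> S ! ((i - 1) mod ?p)"
    by (simp add: cyc_def)
  also have "\<dots> = policy_action \<upsilon> S (Suc ?l + (i - 1) mod ?p)"
    using lt unfolding length_policy_cycle by (simp add: policy_cycle_def del: upt_Suc)
  also have "\<dots> = \<upsilon> (policy_state \<upsilon> S (?l + (i - 1) mod ?p))"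
    by (simp add: policy_action_def)
  also have "\<dots> = \<upsilon> (policy_state \<upsilon> S (?l + (i - 1)))"
    using policy_state_cycle[of \<upsilon> S "(i - 1) div ?p" "(i - 1) mod ?p"]
    by (simp add: div_mult_mod_eq)
  also have "\<dots> = policy_action \<upsilon> S (?l + i)"
    using assms by (simp add: policy_action_def)
  finally show ?thesis .
qed

section \<open>Block functionals as delay costs\<close>

text \<open>The prefix and the repeated block spell out the single sequence \<open>x\<close>;
  \<open>lambda_block\<close> is its series cut at \<open>length z0\<close>.\<close>

lemma lambda_block_eq_delay_cost:
  assumes z0: "z0 = map x [1..<Suc (length z0)]"
    and \<Xi>: "\<And>i. i \<ge> 1 \<Longrightarrow> cyc \<Xi> (int i) = x (length z0 + i)"
  shows "lambda_block p0 \<Psi> S0 z0 \<Xi> = ennreal (1 - p0) * (1 + delay_cost \<Psi> S0 x)"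
proof -
  let ?t = "length z0"
  let ?q = "\<lambda>xs. ennreal (1 - cp_prob p0 \<Psi> S0 xs)"
  let ?a = "\<lambda>s. ennreal (1 - \<Psi> (x s) (mem_state S0 (map x [1..<s])))"
  have q: "?q (map x [1..<Suc s]) = ?a s" if "s \<ge> 1" for s
    using that by simp
  have take: "?q (take s z0) = ?a s" if "s \<in> {1..?t}" for s
  proof -
    have "take s z0 = map x [1..<Suc s]"
      using that by (subst z0) (simp add: take_map take_upt del: upt_Suc)
    then show ?thesis using q[of s] that by simp
  qed
  have app: "?q (z0 @ block_prefix \<Xi> (s - ?t)) = ?a s" if "s \<ge> Suc ?t" for s
  proof -
    have "block_prefix \<Xi> (s - ?t) = map (\<lambda>i. x (i + ?t)) [1..<Suc (s - ?t)]"
      unfolding block_prefix_def by (intro map_cong refl) (simp add: \<Xi> add.commute del: upt_Suc)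
    also have "\<dots> = map x (map (\<lambda>i. i + ?t) [1..<Suc (s - ?t)])" by simp
    also have "map (\<lambda>i. i + ?t) [1..<Suc (s - ?t)] = [Suc ?t..<Suc s]"
      using that by (intro nth_equalityI) (auto simp del: upt_Suc)
    finally have "z0 @ block_prefix \<Xi> (s - ?t) = map x [1..<Suc ?t] @ map x [Suc ?t..<Suc s]"
      using z0 by simp
    also have "\<dots> = map x [1..<Suc s]"
      using that upt_add_eq_append[of 1 "Suc ?t" "s - ?t"] by (simp del: upt_Suc)
    finally show ?thesis using q[of s] that by simp
  qed
  \<comment> \<open>\<open>?P t\<close> has \<open>t + 1\<close> factors, so the term indexed
    \<open>t\<close> in the first sum of \<open>lambda_block\<close> is
    \<open>?P (t - 1)\<close>.\<close>
  let ?P = "\<lambda>t. \<Prod>s=1..Suc t. ?a s"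
  have 1: "(\<Sum>t=1..?t. \<Prod>s=1..t. ?q (take s z0)) = (\<Sum>t<?t. ?P t)"
  proof -
    have "(\<Sum>t=1..?t. \<Prod>s=1..t. ?q (take s z0)) = (\<Sum>t=1..?t. \<Prod>s=1..t. ?a s)"
      by (intro sum.cong prod.cong refl take) auto
    also have "\<dots> = (\<Sum>t<?t. ?P t)"
      by (rule sum.reindex_bij_witness[of _ Suc "\<lambda>t. t - 1"]) auto
    finally show ?thesis .
  qed
  have 2: "(\<Prod>s=1..?t. ?q (take s z0)) *
      (\<Prod>s=Suc ?t..Suc (?t + t). ?q (z0 @ block_prefix \<Xi> (s - ?t))) = ?P (t + ?t)" for t
  proof -
    have "(\<Prod>s=1..?t. ?q (take s z0)) *
        (\<Prod>s=Suc ?t..Suc (?t + t). ?q (z0 @ block_prefix \<Xi> (s - ?t))) =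
      (\<Prod>s=1..?t. ?a s) * (\<Prod>s=Suc ?t..Suc (?t + t). ?a s)"
      by (intro arg_cong2[of _ _ _ _ "(*)"] prod.cong refl take app) auto
    also have "\<dots> = ?P (t + ?t)"
      using prod.ub_add_nat[of 1 ?t ?a "Suc t"] by (simp add: add.commute del: prod.cl_ivl_Suc)
    finally show ?thesis .
  qed
  have "delay_cost \<Psi> S0 x = (\<Sum>t<?t. ?P t) + (\<Sum>t. ?P (t + ?t))"
    unfolding delay_cost_def using suminf_offset[of ?P ?t] by (simp only: summableI add.commute)
  then show ?thesis
    unfolding lambda_block_def Let_def 1 2 by (simp only: add.assoc)
qed

lemma lambda_block_policy:
  fixes \<upsilon> :: "'k :: finite list \<Rightarrow> 'k"
  shows "lambda_block p0 \<Psi> S0 (policy_init \<upsilon> S0) (policy_cycle \<upsilon> S0) =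
    ennreal (1 - p0) * (1 + delay_cost \<Psi> S0 (policy_action \<upsilon> S0))"
  by (rule lambda_block_eq_delay_cost)
    (simp_all add: policy_init_def cyc_policy_cycle del: upt_Suc)

text \<open>A prefix \<open>z\<close> matters only through the memory state it leaves behind. Every
  history that occurs is nonempty, so \<open>p0\<close> drops out.\<close>

lemma lambda_tilde_eq_delay_cost:
  "lambda_tilde p0 \<Psi> S0 \<Xi> =
     (SUP z. 1 + delay_cost \<Psi> (mem_state S0 z) (\<lambda>s. cyc \<Xi> (int s)))"
proof -
  have "cp_prob p0 \<Psi> S0 (z @ block_prefix \<Xi> s) =
      \<Psi> (cyc \<Xi> (int s)) (mem_state (mem_state S0 z) (map (\<lambda>s. cyc \<Xi> (int s)) [1..<s]))"
    if "s \<ge> 1" for z s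
    using that cp_prob_snoc[of p0 \<Psi> S0 "z @ map (\<lambda>s. cyc \<Xi> (int s)) [1..<s]"]
    by (simp add: block_prefix_def mem_state_append)
  then show ?thesis
    unfolding lambda_tilde_def delay_cost_def
    by (intro SUP_cong arg_cong2[of _ _ _ _ "(+)"] suminf_cong prod.cong refl) auto
qed

section \<open>Delay costs compared across several steps\<close>

text \<open>Each of the first \<open>n\<close> terms is at most 1, and so is the product that
  weights the tail.\<close>

lemma delay_cost_le_shift:
  assumes "\<And>x S. length S = \<kappa> \<Longrightarrow> 0 \<le> \<Psi> x S" and "length S = \<kappa>"
  shows "delay_cost \<Psi> S x
    \<le> of_nat n + delay_cost \<Psi> (mem_state S (map x [1..<Suc n])) (\<lambda>s. x (s + n))"
  using assms(2)
proof (induction n arbitrary: S x)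
  case (Suc n)
  have "delay_cost \<Psi> S x \<le> 1 * (1 + delay_cost \<Psi> (Phi (x 1) S) (\<lambda>s. x (Suc s)))"
    unfolding delay_cost_shift[of \<Psi> S x]
    using assms(1)[OF Suc.prems, of "x 1"] by (intro mult_right_mono) (auto simp: ennreal_le_1)
  also have "\<dots> \<le> 1 + (of_nat n + delay_cost \<Psi>
      (mem_state (Phi (x 1) S) (map (\<lambda>s. x (Suc s)) [1..<Suc n])) (\<lambda>s. x (Suc (s + n))))"
    using Suc.IH[of "Phi (x 1) S" "\<lambda>s. x (Suc s)"] Suc.prems
    unfolding mult_1 by (intro add_left_mono) (simp del: upt_Suc)
  finally show ?case
    using map_upt_shift[of "Suc n" x] by (simp add: mem_state_Cons add.assoc del: upt_Suc)
qed simp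

text \<open>The tail after \<open>n\<close> steps is weighted by \<open>n\<close> survival factors,
  each at least \<open>c\<close>.\<close>

lemma delay_cost_ge_shift:
  assumes "\<And>x S. length S = \<kappa> \<Longrightarrow> c \<le> 1 - \<Psi> x S" and "length S = \<kappa>"
  shows "ennreal c ^ n * delay_cost \<Psi> (mem_state S (map x [1..<Suc n])) (\<lambda>s. x (s + n))
    \<le> delay_cost \<Psi> S x"
  using assms(2)
proof (induction n arbitrary: S x)
  case (Suc n)
  let ?d = "delay_cost \<Psi>
      (mem_state (Phi (x 1) S) (map (\<lambda>s. x (Suc s)) [1..<Suc n])) (\<lambda>s. x (Suc (s + n)))"
  have "ennreal c * (ennreal c ^ n * ?d)
      \<le> ennreal (1 - \<Psi> (x 1) S) * (1 + delay_cost \<Psi> (Phi (x 1) S) (\<lambda>s. x (Suc s)))"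
  proof (rule mult_mono)
    show "ennreal c \<le> ennreal (1 - \<Psi> (x 1) S)"
      using assms(1)[OF Suc.prems, of "x 1"] by (rule ennreal_leI)
    have "ennreal c ^ n * ?d \<le> delay_cost \<Psi> (Phi (x 1) S) (\<lambda>s. x (Suc s))"
      using Suc.IH[of "Phi (x 1) S" "\<lambda>s. x (Suc s)"] Suc.prems by (simp del: upt_Suc)
    then show "ennreal c ^ n * ?d \<le> 1 + delay_cost \<Psi> (Phi (x 1) S) (\<lambda>s. x (Suc s))"
      by (rule order_trans) simp
  qed auto
  then show ?case
    unfolding delay_cost_shift[of \<Psi> S x]
    using map_upt_shift[of "Suc n" x] by (simp add: mem_state_Cons mult.assoc del: upt_Suc)
qed simp

text \<open>The first \<open>\<kappa>\<close> treatments of the cycle erase every prefix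
  \<open>z\<close>, so all prefixes share one tail cost \<open>?d\<close>. The policy's own
  trajectory from \<open>S0\<close> has this same tail after \<open>cycle_start + \<kappa>\<close>
  steps, so its cost controls \<open>?d\<close>.\<close>

lemma lambda_tilde_policy_le:
  fixes \<upsilon> :: "'k :: finite list \<Rightarrow> 'k"
  assumes "\<And>x S. length S = \<kappa> \<Longrightarrow> 0 \<le> \<Psi> x S"
    and "\<And>x S. length S = \<kappa> \<Longrightarrow> c \<le> 1 - \<Psi> x S"
    and c: "0 < c" "c \<le> 1" and S0: "length S0 = \<kappa>"
  shows "lambda_tilde p0 \<Psi> S0 (policy_cycle \<upsilon> S0) \<le> 1 + of_nat \<kappa> +
    ennreal (1 / c ^ (CARD('k) ^ \<kappa> + \<kappa>)) * delay_cost \<Psi> S0 (policy_action \<upsilon> S0)"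
proof -
  let ?l = "cycle_start \<upsilon> S0" and ?x = "policy_action \<upsilon> S0" and ?m = "CARD('k) ^ \<kappa> + \<kappa>"
  let ?y = "map (\<lambda>i. ?x (?l + i)) [1..<Suc \<kappa>]"
  let ?d = "delay_cost \<Psi> (rev ?y) (\<lambda>s. ?x (s + (?l + \<kappa>)))"
  have forget: "mem_state S ?y = rev ?y" if "length S = \<kappa>" for S
    using that by (simp add: mem_state_forget del: upt_Suc)
  have le: "delay_cost \<Psi> (mem_state S0 z) (\<lambda>s. cyc (policy_cycle \<upsilon> S0) (int s)) \<le> of_nat \<kappa> + ?d"
    for z
  proof -
    have "delay_cost \<Psi> (mem_state S0 z) (\<lambda>s. cyc (policy_cycle \<upsilon> S0) (int s))
        = delay_cost \<Psi> (mem_state S0 z) (\<lambda>s. ?x (?l + s))"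
      by (rule delay_cost_cong) (rule cyc_policy_cycle)
    also have "\<dots> \<le> of_nat \<kappa> + delay_cost \<Psi> (mem_state (mem_state S0 z) ?y) (\<lambda>s. ?x (?l + (s + \<kappa>)))"
      by (rule delay_cost_le_shift[OF assms(1)]) (auto simp: S0)
    also have "mem_state (mem_state S0 z) ?y = rev ?y"
      by (rule forget) (simp add: S0)
    also have "(\<lambda>s. ?x (?l + (s + \<kappa>))) = (\<lambda>s. ?x (s + (?l + \<kappa>)))"
      by (simp add: ac_simps)
    finally show ?thesis .
  qed
  have "[1..<Suc (?l + \<kappa>)] = [1..<Suc ?l] @ map (\<lambda>i. ?l + i) [1..<Suc \<kappa>]"
    using upt_add_eq_append[of 1 "Suc ?l" \<kappa>] map_add_upt[of ?l "Suc \<kappa>"]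
    by (induction \<kappa>) auto
  then have "map ?x [1..<Suc (?l + \<kappa>)] = map ?x [1..<Suc ?l] @ ?y"
    by (simp del: upt_Suc)
  then have "mem_state S0 (map ?x [1..<Suc (?l + \<kappa>)]) = rev ?y"
    using forget[of "mem_state S0 (map ?x [1..<Suc ?l])"] S0
    by (simp only: mem_state_append length_mem_state)
  with delay_cost_ge_shift[where n = "?l + \<kappa>" and x = ?x, OF assms(2) S0]
  have ge: "ennreal c ^ (?l + \<kappa>) * ?d \<le> delay_cost \<Psi> S0 ?x"
    by (simp only:)
  \<comment> \<open>The cycle start depends on the policy; the return-time bound replaces it by a
    fixed exponent.\<close>
  have "?l \<le> CARD('k) ^ \<kappa>"
    using return_time_props(1,3)[of \<upsilon> S0] S0 by simp
  then have "c ^ ?m \<le> c ^ (?l + \<kappa>)"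
    using c by (intro power_decreasing) auto
  then have "ennreal (c ^ ?m) * ?d \<le> ennreal (c ^ (?l + \<kappa>)) * ?d"
    by (intro mult_right_mono ennreal_leI) auto
  also have "\<dots> \<le> delay_cost \<Psi> S0 ?x"
    using ge c by (simp add: ennreal_power)
  finally have "ennreal (1 / c ^ ?m) * (ennreal (c ^ ?m) * ?d)
      \<le> ennreal (1 / c ^ ?m) * delay_cost \<Psi> S0 ?x"
    by (intro mult_left_mono) auto
  moreover have "ennreal (1 / c ^ ?m) * (ennreal (c ^ ?m) * ?d) = ?d"
    using c by (simp add: mult.assoc[symmetric] ennreal_mult[symmetric])
  ultimately have d: "?d \<le> ennreal (1 / c ^ ?m) * delay_cost \<Psi> S0 ?x"
    by simp
  show ?thesis
    unfolding lambda_tilde_eq_delay_cost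
  proof (rule SUP_least)
    fix z
    have "1 + delay_cost \<Psi> (mem_state S0 z) (\<lambda>s. cyc (policy_cycle \<upsilon> S0) (int s))
        \<le> 1 + (of_nat \<kappa> + ennreal (1 / c ^ ?m) * delay_cost \<Psi> S0 ?x)"
      by (intro add_left_mono order_trans[OF le] d)
    then show "1 + delay_cost \<Psi> (mem_state S0 z) (\<lambda>s. cyc (policy_cycle \<upsilon> S0) (int s))
        \<le> 1 + of_nat \<kappa> + ennreal (1 / c ^ ?m) * delay_cost \<Psi> S0 ?x"
      by (simp only: add.assoc)
  qed
qed

section \<open>Average reward\<close>

lemma take_rev_map_upt:
  "n \<le> t \<Longrightarrow> take n (rev (map x [1..<Suc t])) = map (\<lambda>i. x (Suc t - i)) [1..<Suc n]"
  by (intro nth_equalityI) (auto simp: rev_nth Suc_diff_Suc simp del: upt_Suc)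

text \<open>The cyclic extension reads backwards past the start of the block, where the trajectory
  itself need not be periodic. Moving \<open>\<kappa>\<close> whole periods ahead places all
  remembered treatments inside the periodic range.\<close>

lemma policy_state_cycle_eq_cyc:
  fixes \<upsilon> :: "'k :: finite list \<Rightarrow> 'k"
  assumes "length S = \<kappa>"
  shows "map (\<lambda>i. cyc (policy_cycle \<upsilon> S) (int (Suc j) - int i)) [1..<Suc \<kappa>] =
    policy_state \<upsilon> S (cycle_start \<upsilon> S + j)"
proof -
  let ?l = "cycle_start \<upsilon> S" and ?p = "length (policy_cycle \<upsilon> S)"
  let ?x = "policy_action \<upsilon> S" and ?t = "cycle_start \<upsilon> S + (\<kappa> * length (policy_cycle \<upsilon> S) + j)"
  \<comment> \<open>The period is at least 1, so \<open>\<kappa>\<close> periods cover the memory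
    length.\<close>
  have p: "\<kappa> \<le> \<kappa> * ?p"
    using length_policy_cycle_pos[of \<upsilon> S] by (cases ?p) auto
  have c: "cyc (policy_cycle \<upsilon> S) (int (Suc j) - int i) = ?x (Suc ?t - i)" if "i \<in> {1..\<kappa>}" for i
  proof -
    have i: "i \<le> \<kappa> * ?p + j" 
      using that by (intro trans_le_add1 order_trans[OF _ p]) simp
    have "cyc (policy_cycle \<upsilon> S) (int (Suc j) - int i) =
        cyc (policy_cycle \<upsilon> S) (int (Suc j) - int i + int \<kappa> * int ?p)"
      by (rule cyc_periodic[symmetric])
    also have "int (Suc j) - int i + int \<kappa> * int ?p = int (Suc (\<kappa> * ?p + j) - i)"
      using i by (simp add: of_nat_diff)
    also have "cyc (policy_cycle \<upsilon> S) \<dots> = ?x (?l + (Suc (\<kappa> * ?p + j) - i))"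
      using i by (intro cyc_policy_cycle) auto
    also have "?l + (Suc (\<kappa> * ?p + j) - i) = Suc ?t - i"
      using i by simp
    finally show ?thesis .
  qed
  have "policy_state \<upsilon> S (?l + j) = policy_state \<upsilon> S ?t"
    by (rule policy_state_cycle[symmetric])
  also have "\<dots> = take \<kappa> (rev (map ?x [1..<Suc ?t]))"
    unfolding policy_state_eq_mem_state[of \<upsilon> S ?t]
    using mem_state_forget[of S "map ?x [1..<Suc ?t]"] trans_le_add1[OF p, of "?l + j"]
    by (simp add: assms add_ac del: upt_Suc)
  also have "\<dots> = map (\<lambda>i. ?x (Suc ?t - i)) [1..<Suc \<kappa>]"
    using p by (intro take_rev_map_upt) linarith
  also have "\<dots> = map (\<lambda>i. cyc (policy_cycle \<upsilon> S) (int (Suc j) - int i)) [1..<Suc \<kappa>]"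
    by (intro map_cong refl c[symmetric]) auto
  finally show ?thesis by (rule sym)
qed

lemma D_block_policy_cycle:
  fixes \<upsilon> :: "'k :: finite list \<Rightarrow> 'k" and S :: "'k list"
  defines "T \<equiv> \<lambda>j. policy_state \<upsilon> S (cycle_start \<upsilon> S + j)"
  assumes "length S = \<kappa>"
  shows "D_block \<kappa> I \<Psi> (policy_cycle \<upsilon> S) =
    (\<Sum>j<length (policy_cycle \<upsilon> S). reward I \<Psi> (\<upsilon> (T j)) (T j)) / length (policy_cycle \<upsilon> S)"
proof -
  let ?\<Xi> = "policy_cycle \<upsilon> S"
  have a: "cyc ?\<Xi> (int (Suc j)) = \<upsilon> (T j)" for j
    using cyc_policy_cycle[of "Suc j" \<upsilon> S] by (simp add: T_def policy_action_def)
  have sum: "(\<Sum>j=1..length ?\<Xi>. F j) = (\<Sum>j<length ?\<Xi>. F (Suc j))" for F :: "nat \<Rightarrow> real"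
    by (rule sum.reindex_bij_witness[of _ Suc "\<lambda>j. j - 1"]) auto
  show ?thesis
    unfolding D_block_def I_block_def d_block_def sum a policy_state_cycle_eq_cyc[OF assms(2)]
    by (simp add: T_def reward_def sum.distrib add_divide_distrib)
qed

text \<open>A greedy treatment attains the maximum, so its reward is \<open>l\<close> plus an
  increment of \<open>h\<close>; around the closed cycle the increments cancel.\<close>

lemma D_block_optimal_policy:
  fixes \<upsilon> :: "'k :: finite list \<Rightarrow> 'k"
  assumes avg: "average_reward_eq \<kappa> I \<Psi> l h" and opt: "optimal_reward_policy \<kappa> I \<Psi> h \<upsilon>"
    and S: "length S = \<kappa>"
  shows "D_block \<kappa> I \<Psi> (policy_cycle \<upsilon> S) = l"
proof -
  let ?p = "length (policy_cycle \<upsilon> S)"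
  let ?T = "\<lambda>j. policy_state \<upsilon> S (cycle_start \<upsilon> S + j)"
  have r: "reward I \<Psi> (\<upsilon> U) U = l + (h U - h (Phi (\<upsilon> U) U))" if "length U = \<kappa>" for U
  proof -
    have "(MAX x. reward I \<Psi> x U + h (Phi x U)) = reward I \<Psi> (\<upsilon> U) U + h (Phi (\<upsilon> U) U)"
      using opt that by (intro Max_eqI)
        (auto simp: optimal_reward_policy_def is_arg_max_linorder)
    moreover have "l + h U = (MAX x. reward I \<Psi> x U + h (Phi x U))"
      using avg that by (simp add: average_reward_eq_def)
    ultimately show ?thesis by linarith
  qed
  have "(\<Sum>j<?p. reward I \<Psi> (\<upsilon> (?T j)) (?T j)) = (\<Sum>j<?p. l + (h (?T j) - h (?T (Suc j))))"
    using S by (intro sum.cong refl) (simp add: r)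
  also have "\<dots> = ?p * l + (h (?T 0) - h (?T ?p))"
    unfolding sum.distrib sum_lessThan_telescope'[of "\<lambda>j. h (?T j)"] by simp
  also have "?T ?p = ?T 0"
    using policy_state_cycle[of \<upsilon> S 1 0] by simp
  finally show ?thesis
    unfolding D_block_policy_cycle[OF S] using length_policy_cycle_pos[of \<upsilon> S] by simp
qed

text \<open>An average lies between bounds on its terms. This makes \<open>D_star\<close> bounded,
  and bounded away from 0 so that it can be divided by.\<close>

lemma D_block_policy_cycle_bounds:
  fixes \<upsilon> :: "'k :: finite list \<Rightarrow> 'k"
  assumes "\<And>x S. length S = \<kappa> \<Longrightarrow> reward I \<Psi> x S \<in> {a..b}" and S: "length S = \<kappa>"
  shows "D_block \<kappa> I \<Psi> (policy_cycle \<upsilon> S) \<in> {a..b}"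
proof -
  let ?p = "length (policy_cycle \<upsilon> S)"
  let ?T = "\<lambda>j. policy_state \<upsilon> S (cycle_start \<upsilon> S + j)"
  have r: "reward I \<Psi> (\<upsilon> (?T j)) (?T j) \<in> {a..b}" for j
    by (rule assms(1)) (simp add: S)
  have "real ?p * a \<le> (\<Sum>j<?p. reward I \<Psi> (\<upsilon> (?T j)) (?T j))"
    using sum_bounded_below[of "{..<?p}" a "\<lambda>j. reward I \<Psi> (\<upsilon> (?T j)) (?T j)"] r by simp
  moreover have "(\<Sum>j<?p. reward I \<Psi> (\<upsilon> (?T j)) (?T j)) \<le> real ?p * b"
    using sum_bounded_above[of "{..<?p}" "\<lambda>j. reward I \<Psi> (\<upsilon> (?T j)) (?T j)" b] r by simp
  ultimately show ?thesis
    unfolding D_block_policy_cycle[OF S] using length_policy_cycle_pos[of \<upsilon> S]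
    by (simp add: field_simps)
qed

section \<open>Rewards of arbitrary treatment sequences\<close>

text \<open>Any treatment is dominated by the maximum in the optimality equation, and
  \<open>h\<close> telescopes. The bound is pathwise, so it covers adaptive rules.\<close>

lemma reward_sum_le:
  fixes x :: "nat \<Rightarrow> 'k :: finite"
  assumes "average_reward_eq \<kappa> I \<Psi> l h" and "length S = \<kappa>"
  shows "(\<Sum>s=1..n. reward I \<Psi> (x s) (mem_state S (map x [1..<s])))
    \<le> real n * l + h S - h (mem_state S (map x [1..<Suc n]))"
proof (induction n)
  case (Suc n)
  let ?U = "mem_state S (map x [1..<Suc n])"
  have "reward I \<Psi> (x (Suc n)) ?U + h (Phi (x (Suc n)) ?U) \<le> (MAX y. reward I \<Psi> y ?U + h (Phi y ?U))"
    by (rule Max_ge) auto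
  also have "\<dots> = l + h ?U"
    using assms unfolding average_reward_eq_def by (metis length_mem_state)
  finally have "reward I \<Psi> (x (Suc n)) ?U \<le> l + h ?U - h (Phi (x (Suc n)) ?U)" by simp
  moreover have "mem_state S (map x [1..<Suc (Suc n)]) = Phi (x (Suc n)) ?U"
    by (simp add: mem_state_snoc)
  ultimately show ?case using Suc.IH by (simp add: algebra_simps del: upt_Suc)
qed simp

text \<open>Any memory state can be steered to any other within \<open>\<kappa>\<close> steps, each of nonnegative reward;
  hence the span of \<open>h\<close> is at most \<open>\<kappa> l\<close>, uniformly in the model.\<close>

lemma average_reward_span:
  fixes I :: "'k :: finite \<Rightarrow> real"
  assumes avg: "average_reward_eq \<kappa> I \<Psi> l h"
    and pos: "\<And>x S. length S = \<kappa> \<Longrightarrow> 0 \<le> reward I \<Psi> x S"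
    and S: "length S = \<kappa>" "length T = \<kappa>"
  shows "h T - h S \<le> real \<kappa> * l"
proof -
  define x where "x s = rev T ! (s - 1)" for s
  have "map x [1..<Suc \<kappa>] = rev T"
    using S by (intro nth_equalityI) (auto simp: x_def simp del: upt_Suc)
  then have "mem_state S (map x [1..<Suc \<kappa>]) = T"
    using S by (simp only: mem_state_reach)
  moreover have "0 \<le> (\<Sum>s=1..\<kappa>. reward I \<Psi> (x s) (mem_state S (map x [1..<s])))"
    using S by (intro sum_nonneg pos) simp
  \<comment> \<open>The nonnegative reward sum on the way from \<open>S\<close> to \<open>T\<close>
    is at most \<open>\<kappa> * l + h S - h T\<close>.\<close>
  ultimately show ?thesis using reward_sum_le[OF avg S(1), of x \<kappa>] by simp
qed

lemma reward_sum_le_uniform: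
  fixes x :: "nat \<Rightarrow> 'k :: finite"
  assumes "average_reward_eq \<kappa> I \<Psi> l h"
    and "\<And>x S. length S = \<kappa> \<Longrightarrow> 0 \<le> reward I \<Psi> x S"
    and "length S = \<kappa>"
  shows "(\<Sum>s=1..n. reward I \<Psi> (x s) (mem_state S (map x [1..<s]))) \<le> (real n + real \<kappa>) * l"
  using reward_sum_le[OF assms(1,3), of x n]
    average_reward_span[OF assms(1,2), of "mem_state S (map x [1..<Suc n])" S] assms(3)
  by (simp add: algebra_simps del: upt_Suc)

lemma treatments_add:
  "treatments X (t + s) w = treatments X t w @ map (\<lambda>j. X (t + j) w) [1..<Suc s]"
  by (induction s) (simp_all add: treatments_def)

text \<open>The past up to \<open>t\<close> enters only as an initial state, so a bound uniform in
  the initial state is uniform in \<open>t\<close>.\<close>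

lemma reward_eq_history:
  assumes "s \<ge> 1"
  shows "I (X (t + s) w) + omega (cp_prob p0 \<Psi> S0 (treatments X (t + s) w)) =
    reward I \<Psi> (X (t + s) w)
      (mem_state (mem_state S0 (treatments X t w)) (map (\<lambda>j. X (t + j) w) [1..<s]))"
proof -
  have "treatments X (t + s) w =
      (treatments X t w @ map (\<lambda>j. X (t + j) w) [1..<s]) @ [X (t + s) w]"
    using assms by (simp add: treatments_add)
  then show ?thesis
    unfolding reward_def by (simp only: cp_prob_snoc mem_state_append)
qed

section \<open>Asymptotic optimality\<close>

theorem lemma6p2:
  fixes \<mu> :: "('y :: polish_space) measure"
    and f g :: "'k :: finite \<Rightarrow> 'y \<Rightarrow> real"
    and \<kappa> :: nat
    and S0 :: "'k list"
    and p0 :: "real \<Rightarrow> real"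
    and \<Psi> :: "real \<Rightarrow> 'k \<Rightarrow> 'k list \<Rightarrow> real"
    and c :: real
    and M :: "real \<Rightarrow> ('k, 'y) rule \<Rightarrow> 'w measure"
    and \<Theta> :: "real \<Rightarrow> ('k, 'y) rule \<Rightarrow> 'w \<Rightarrow> enat"
    and X :: "real \<Rightarrow> ('k, 'y) rule \<Rightarrow> nat \<Rightarrow> 'w \<Rightarrow> 'k"
    and Y :: "real \<Rightarrow> ('k, 'y) rule \<Rightarrow> nat \<Rightarrow> 'w \<Rightarrow> 'y"
    and \<upsilon>1 \<upsilon>2 :: "real \<Rightarrow> 'k list \<Rightarrow> 'k"
    and l' :: "real \<Rightarrow> real"
    and h' :: "real \<Rightarrow> 'k list \<Rightarrow> real"
    and z0 \<Xi>1 \<Xi>2 :: "real \<Rightarrow> 'k list"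
    and lambda_star :: "real \<Rightarrow> ennreal"
    and D_star :: "real \<Rightarrow> real"
    and N :: "real \<Rightarrow> real \<Rightarrow> nat"
  assumes K: "CARD('k) \<ge> 2"
    and response: "response_model \<mu> f g"
    and S0: "length S0 = \<kappa>"
    and p0: "\<And>\<alpha>. \<alpha> \<in> {0<..<1} \<Longrightarrow> p0 \<alpha> \<in> {0..<1}"
    and Psi: "\<And>\<alpha> x S. \<alpha> \<in> {0<..<1} \<Longrightarrow> length S = \<kappa> \<Longrightarrow> \<Psi> \<alpha> x S \<in> {0..<1}"
    and c: "c \<in> {0<..<1}"
    and bound: "\<forall>\<^sub>F \<alpha> in at_right 0. \<forall>z. cp_prob (p0 \<alpha>) (\<Psi> \<alpha>) S0 z \<le> 1 - c"
    and process: "\<And>\<alpha> \<delta>. \<alpha> \<in> {0<..<1} \<Longrightarrow> assignment_rule \<delta> \<Longrightarrow>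
      changepoint_process \<mu> f g (p0 \<alpha>) (\<Psi> \<alpha>) S0 \<delta> (M \<alpha> \<delta>) (\<Theta> \<alpha> \<delta>) (X \<alpha> \<delta>) (Y \<alpha> \<delta>)"
    and upsilon1: "\<And>\<alpha>. \<alpha> \<in> {0<..<1} \<Longrightarrow> optimal_delay_policy \<kappa> (\<Psi> \<alpha>) (\<upsilon>1 \<alpha>)"
    and avg: "\<And>\<alpha>. \<alpha> \<in> {0<..<1} \<Longrightarrow>
      average_reward_eq \<kappa> (info \<mu> f g) (\<Psi> \<alpha>) (l' \<alpha>) (h' \<alpha>)"
    and upsilon2: "\<And>\<alpha>. \<alpha> \<in> {0<..<1} \<Longrightarrow>
      optimal_reward_policy \<kappa> (info \<mu> f g) (\<Psi> \<alpha>) (h' \<alpha>) (\<upsilon>2 \<alpha>)"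
  defines "z0 \<equiv> \<lambda>\<alpha>. policy_init (\<upsilon>1 \<alpha>) S0"
    and "\<Xi>1 \<equiv> \<lambda>\<alpha>. policy_cycle (\<upsilon>1 \<alpha>) S0"
    and "\<Xi>2 \<equiv> \<lambda>\<alpha>. policy_cycle (\<upsilon>2 \<alpha>) S0"
    and "lambda_star \<equiv> \<lambda>\<alpha>.
      INF \<delta>\<in>Collect assignment_rule. \<integral>\<^sup>+w. ennreal_of_enat (\<Theta> \<alpha> \<delta> w) \<partial>M \<alpha> \<delta>"
    and "D_star \<equiv> \<lambda>\<alpha>. D_block \<kappa> (info \<mu> f g) (\<Psi> \<alpha>) (\<Xi>2 \<alpha>)"
    and "N \<equiv> \<lambda>\<epsilon> \<alpha>. nat \<lfloor>(1 - \<epsilon>) * \<bar>ln \<alpha>\<bar> / D_star \<alpha>\<rfloor>"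
  shows
    "(\<forall>\<alpha>\<in>{0<..<1}. lambda_star \<alpha> = lambda_block (p0 \<alpha>) (\<Psi> \<alpha>) S0 (z0 \<alpha>) (\<Xi>1 \<alpha>)) \<and>
     ((\<lambda>\<alpha>. ennreal \<alpha> * lambda_tilde (p0 \<alpha>) (\<Psi> \<alpha>) S0 (\<Xi>1 \<alpha>)
            / (lambda_star \<alpha> + ennreal \<bar>ln \<alpha>\<bar>)) \<longlongrightarrow> 0) (at_right 0) \<and>
     D_star \<in> O[at_right 0](\<lambda>_. 1) \<and>
     (\<forall>\<epsilon>\<in>{0<..<1}.
        Limsup (at_right 0) (\<lambda>\<alpha>.
          SUP t. SUP \<delta>\<in>Collect assignment_rule. SUP w\<in>space (M \<alpha> \<delta>).
            ereal (1 / (D_star \<alpha> * real (N \<epsilon> \<alpha>)) *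
              (\<Sum>s=1..N \<epsilon> \<alpha>.
                 info \<mu> f g (X \<alpha> \<delta> (t + s) w) +
                 omega (cp_prob (p0 \<alpha>) (\<Psi> \<alpha>) S0 (treatments (X \<alpha> \<delta>) (t + s) w)))))
        \<le> ereal (1 + \<epsilon> / 2))"
proof -

  \<comment> \<open>Constants and bounds for small \<open>\<alpha>\<close>\<close>
  define I where "I = info \<mu> f g"
  define a where "a = Min (range I)"
  \<comment> \<open>\<open>\<bar>ln c\<bar>\<close> bounds \<open>omega\<close> on
    \<open>{0..1 - c}\<close>, so rewards lie in \<open>{a..b}\<close>.\<close>
  define b where "b = Max (range I) + \<bar>ln c\<bar>"
  define m where "m = CARD('k) ^ \<kappa> + \<kappa>"
  have cp: "cp_prob (p0 \<alpha>) (\<Psi> \<alpha>) S0 xs \<le> 1" if "\<alpha> \<in> {0<..<1}" for \<alpha> xs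
    using p0[OF that] Psi[OF that] S0 by (cases xs rule: rev_cases)
      (auto simp: cp_prob_def intro!: less_imp_le)
  have small: "\<forall>\<^sub>F \<alpha> in at_right 0. \<alpha> \<in> {0<..<1} \<and> p0 \<alpha> \<le> 1 - c \<and>
      (\<forall>x S. length S = \<kappa> \<longrightarrow> \<Psi> \<alpha> x S \<in> {0..1 - c})"
  proof -
    have "\<forall>\<^sub>F \<alpha> in at_right 0. \<alpha> \<in> {0<..<1 :: real}"
      by (rule eventually_at_right_real) simp
    with bound show ?thesis
    proof eventually_elim
      case (elim \<alpha>)
      have "p0 \<alpha> \<le> 1 - c" using elim(1)[rule_format, of "[]"] by (simp add: cp_prob_def)
      moreover have "\<Psi> \<alpha> x S \<in> {0..1 - c}" if "length S = \<kappa>" for x S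
        \<comment> \<open>The history \<open>rev S\<close> brings the memory into state
          \<open>S\<close>, so the hypothesis on \<open>cp_prob\<close> reaches every pair of a
          treatment and a state.\<close>
        using elim(1)[rule_format, of "rev S @ [x]"] Psi[OF elim(2) that, of x] that S0
        by (simp add: mem_state_reach)
      ultimately show ?case using elim(2) by blast
    qed
  qed
  have ln_large: "\<forall>\<^sub>F \<alpha> in at_right 0. R \<le> \<bar>ln \<alpha>\<bar>" for R :: real
  proof -
    have "\<forall>\<^sub>F \<alpha> in at_right 0. ln \<alpha> \<le> - R"
      using ln_at_0 unfolding filterlim_at_bot by blast
    then show ?thesis by eventually_elim linarith
  qed

  \<comment> \<open>The minimal expected change-point\<close>
  have star: "lambda_star \<alpha> =
      ennreal (1 - p0 \<alpha>) * (1 + delay_cost (\<Psi> \<alpha>) S0 (policy_action (\<upsilon>1 \<alpha>) S0))"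
    if \<alpha>: "\<alpha> \<in> {0<..<1}" for \<alpha>
  proof (rule antisym)
    let ?x = "policy_action (\<upsilon>1 \<alpha>) S0"
    \<comment> \<open>The optimal trajectory is known in advance, so a rule ignoring all
      observations realises it.\<close>
    let ?\<delta> = "\<lambda>t _. ?x t :: 'k"
    have \<delta>: "assignment_rule (?\<delta> :: ('k, 'y) rule)"
      by (simp add: assignment_rule_def)
    note proc = process[OF \<alpha> \<delta>]
    have "lambda_star \<alpha> \<le> (\<integral>\<^sup>+w. ennreal_of_enat (\<Theta> \<alpha> ?\<delta> w) \<partial>M \<alpha> ?\<delta>)"
      unfolding lambda_star_def using \<delta> by (intro INF_lower) simp
    also have "\<dots> = ennreal (1 - p0 \<alpha>) * (1 + delay_cost (\<Psi> \<alpha>) S0 ?x)"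
      using changepoint_process.X_rule[OF proc]
      by (intro changepoint_process.expected_changepoint_deterministic[OF proc] cp[OF \<alpha>]) auto
    finally show "lambda_star \<alpha> \<le> ennreal (1 - p0 \<alpha>) * (1 + delay_cost (\<Psi> \<alpha>) S0 ?x)" .
    show "ennreal (1 - p0 \<alpha>) * (1 + delay_cost (\<Psi> \<alpha>) S0 ?x) \<le> lambda_star \<alpha>"
      unfolding lambda_star_def delay_cost_optimal_policy[OF upsilon1[OF \<alpha>] S0]
    proof (rule INF_greatest)
      fix \<delta> :: "('k, 'y) rule" assume "\<delta> \<in> Collect assignment_rule"
      then have "assignment_rule \<delta>" by simp
      from changepoint_process.expected_changepoint_ge[OF process[OF \<alpha> this] cp[OF \<alpha>]]
      show "ennreal (1 - p0 \<alpha>) * (1 + V_opt (\<Psi> \<alpha>) S0)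
          \<le> (\<integral>\<^sup>+w. ennreal_of_enat (\<Theta> \<alpha> \<delta> w) \<partial>M \<alpha> \<delta>)" .
    qed
  qed
  have part1: "\<forall>\<alpha>\<in>{0<..<1}. lambda_star \<alpha> = lambda_block (p0 \<alpha>) (\<Psi> \<alpha>) S0 (z0 \<alpha>) (\<Xi>1 \<alpha>)"
    unfolding z0_def \<Xi>1_def lambda_block_policy using star by blast

  \<comment> \<open>Negligibility of \<open>lambda_tilde\<close>\<close>
  \<comment> \<open>The last summand multiplies the factor of \<open>lambda_tilde_policy_le\<close>
    by the \<open>1 / c\<close> lost in passing from the delay cost to \<open>lambda_star\<close>,
    as \<open>1 - p0 \<alpha> \<ge> c\<close>.\<close>
  define B where "B = 1 + real \<kappa> + 1 / c ^ m * (1 / c)"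
  have B: "0 \<le> 1 / c ^ m * (1 / c)" using c by simp
  have ratio: "\<forall>\<^sub>F \<alpha> in at_right 0. ennreal \<alpha> * lambda_tilde (p0 \<alpha>) (\<Psi> \<alpha>) S0 (\<Xi>1 \<alpha>)
            / (lambda_star \<alpha> + ennreal \<bar>ln \<alpha>\<bar>) \<le> ennreal (\<alpha> * B)"
    using small ln_large[of 1]
  proof eventually_elim
    case (elim \<alpha>)
    let ?d = "delay_cost (\<Psi> \<alpha>) S0 (policy_action (\<upsilon>1 \<alpha>) S0)"
    let ?y = "lambda_star \<alpha> + ennreal \<bar>ln \<alpha>\<bar>"
    have \<alpha>: "\<alpha> \<in> {0<..<1}" using elim by blast
    have "1 \<le> ennreal \<bar>ln \<alpha>\<bar>" using elim(2) by simp
    \<comment> \<open>The logarithm keeps the denominator at least 1, so it absorbs the additive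
      constant \<open>1 + \<kappa>\<close>.\<close>
    then have y: "1 \<le> ?y" by (rule add_increasing[OF zero_le])
    have "ennreal c * ?d \<le> lambda_star \<alpha>"
      unfolding star[OF \<alpha>] using elim by (intro mult_mono ennreal_leI) auto
    then have "ennreal (1 / c) * (ennreal c * ?d) \<le> ennreal (1 / c) * lambda_star \<alpha>"
      by (intro mult_left_mono) auto
    moreover have "ennreal (1 / c) * (ennreal c * ?d) = ?d"
      using c by (simp add: mult.assoc[symmetric] ennreal_mult[symmetric])
    ultimately have d: "?d \<le> ennreal (1 / c) * lambda_star \<alpha>" by simp
    have "lambda_tilde (p0 \<alpha>) (\<Psi> \<alpha>) S0 (\<Xi>1 \<alpha>) \<le> 1 + of_nat \<kappa> + ennreal (1 / c ^ m) * ?d"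
      unfolding \<Xi>1_def m_def using elim c S0
      by (intro lambda_tilde_policy_le) (auto simp: algebra_simps)
    also have "\<dots> \<le> 1 + of_nat \<kappa> + ennreal (1 / c ^ m) * (ennreal (1 / c) * lambda_star \<alpha>)"
      by (intro add_left_mono mult_left_mono d) auto
    also have "\<dots> = ennreal (1 + real \<kappa>) * 1 + ennreal (1 / c ^ m * (1 / c)) * lambda_star \<alpha>"
    proof -
      have "ennreal (1 / c ^ m * (1 / c)) = ennreal (1 / c ^ m) * ennreal (1 / c)"
        using c by (intro ennreal_mult) auto
      moreover have "1 + of_nat \<kappa> = ennreal (1 + real \<kappa>) * 1"
        by (simp add: ennreal_of_nat_eq_real_of_nat)
      ultimately show ?thesis by (simp only: mult.assoc)
    qed
    also have "\<dots> \<le> ennreal (1 + real \<kappa>) * ?y + ennreal (1 / c ^ m * (1 / c)) * ?y"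
      using y by (intro add_mono mult_left_mono) auto
    also have "\<dots> = ennreal B * ?y"
      unfolding B_def using B by (subst ennreal_plus) (auto simp: distrib_right)
    finally have "ennreal \<alpha> * lambda_tilde (p0 \<alpha>) (\<Psi> \<alpha>) S0 (\<Xi>1 \<alpha>) \<le> ennreal \<alpha> * (ennreal B * ?y)"
      by (intro mult_left_mono) auto
    also have "\<dots> = ?y * ennreal (\<alpha> * B)"
      using \<alpha> B by (simp add: ennreal_mult B_def mult_ac)
    finally show ?case
      \<comment> \<open>Only positivity of the divisor is asked for, so an infinite
        \<open>lambda_star\<close> is covered.\<close>
      by (rule divide_le_posI_ennreal[OF less_le_trans[OF zero_less_one y]])
  qed
  have lim: "((\<lambda>\<alpha>. ennreal (\<alpha> * B)) \<longlongrightarrow> 0) (at_right 0)"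
    unfolding ennreal_0[symmetric] by (intro tendsto_ennrealI) (auto intro!: tendsto_eq_intros)
  have part2: "((\<lambda>\<alpha>. ennreal \<alpha> * lambda_tilde (p0 \<alpha>) (\<Psi> \<alpha>) S0 (\<Xi>1 \<alpha>)
            / (lambda_star \<alpha> + ennreal \<bar>ln \<alpha>\<bar>)) \<longlongrightarrow> 0) (at_right 0)"
    by (rule tendsto_sandwich[OF always_eventually ratio tendsto_const lim]) (intro allI zero_le)

  \<comment> \<open>Boundedness of \<open>D_star\<close>\<close>
  have I_pos: "0 < I x" for x
    unfolding I_def using response by (rule response_model.info_pos)
  have a_pos: "0 < a" unfolding a_def using I_pos by simp
  have D: "\<forall>\<^sub>F \<alpha> in at_right 0. \<alpha> \<in> {0<..<1} \<and> D_star \<alpha> \<in> {a..b} \<and>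
      (\<forall>x S. length S = \<kappa> \<longrightarrow> 0 \<le> reward I (\<Psi> \<alpha>) x S)"
    using small
  proof eventually_elim
    case (elim \<alpha>)
    have r: "reward I (\<Psi> \<alpha>) x S \<in> {a..b}" if "length S = \<kappa>" for x S
    proof -
      have "\<Psi> \<alpha> x S \<in> {0..1 - c}" using elim that by blast
      then have "ln c \<le> ln (1 - \<Psi> \<alpha> x S)" "ln (1 - \<Psi> \<alpha> x S) \<le> 0"
        using c by auto
      then have "omega (\<Psi> \<alpha> x S) \<in> {0..\<bar>ln c\<bar>}"
        unfolding omega_def by auto
      moreover have "a \<le> I x" "I x \<le> Max (range I)" unfolding a_def by auto
      ultimately show ?thesis
        unfolding reward_def b_def atLeastAtMost_iff by linarith
    qed
    moreover have "0 \<le> reward I (\<Psi> \<alpha>) x S" if "length S = \<kappa>" for x S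
      using r[OF that, of x] a_pos by auto
    ultimately show ?case
      using elim D_block_policy_cycle_bounds[OF r S0, of "\<upsilon>2 \<alpha>"]
      unfolding D_star_def \<Xi>2_def I_def by blast
  qed
  have part3: "D_star \<in> O[at_right 0](\<lambda>_. 1)"
    by (rule bigoI[of _ b], rule eventually_mono[OF D]) (use a_pos in auto)

  \<comment> \<open>The limsup bound\<close>
  have part4: "Limsup (at_right 0) (\<lambda>\<alpha>.
          SUP t. SUP \<delta>\<in>Collect assignment_rule. SUP w\<in>space (M \<alpha> \<delta>).
            ereal (1 / (D_star \<alpha> * real (N \<epsilon> \<alpha>)) *
              (\<Sum>s=1..N \<epsilon> \<alpha>.
                 info \<mu> f g (X \<alpha> \<delta> (t + s) w) +
                 omega (cp_prob (p0 \<alpha>) (\<Psi> \<alpha>) S0 (treatments (X \<alpha> \<delta>) (t + s) w)))))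
        \<le> ereal (1 + \<epsilon> / 2)" if \<epsilon>: "\<epsilon> \<in> {0<..<1}" for \<epsilon>
  proof (rule Limsup_bounded)
    \<comment> \<open>\<open>N \<ge> 2 * \<kappa> / \<epsilon>\<close> makes the excess
      \<open>\<kappa>\<close> at most \<open>N * \<epsilon> / 2\<close>; the added 1 keeps
      \<open>N\<close> positive when \<open>\<kappa> = 0\<close>.\<close>
    let ?R = "2 * real \<kappa> / \<epsilon> + 1"
    show "\<forall>\<^sub>F \<alpha> in at_right 0. (SUP t. SUP \<delta>\<in>Collect assignment_rule. SUP w\<in>space (M \<alpha> \<delta>).
            ereal (1 / (D_star \<alpha> * real (N \<epsilon> \<alpha>)) *
              (\<Sum>s=1..N \<epsilon> \<alpha>.
                 info \<mu> f g (X \<alpha> \<delta> (t + s) w) +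
                 omega (cp_prob (p0 \<alpha>) (\<Psi> \<alpha>) S0 (treatments (X \<alpha> \<delta>) (t + s) w)))))
        \<le> ereal (1 + \<epsilon> / 2)"
      \<comment> \<open>The further 1 pays for the floor in \<open>N\<close>, and \<open>b\<close>
        stands in for the varying \<open>D_star \<alpha>\<close>.\<close>
      using D ln_large[of "(?R + 1) * b / (1 - \<epsilon>)"]
    proof eventually_elim
      case (elim \<alpha>)
      let ?n = "N \<epsilon> \<alpha>"
      have \<alpha>: "\<alpha> \<in> {0<..<1}" and Da: "0 < D_star \<alpha>" "D_star \<alpha> \<le> b"
        using elim(1) a_pos by auto
      have R: "?R > 0" using \<epsilon> by (intro add_nonneg_pos) auto
      have "(?R + 1) * D_star \<alpha> \<le> (?R + 1) * b"
        using Da R by (intro mult_left_mono) auto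
      also have "\<dots> \<le> (1 - \<epsilon>) * \<bar>ln \<alpha>\<bar>"
        using elim(2) \<epsilon> by (simp add: pos_divide_le_eq mult.commute)
      finally have "?R + 1 \<le> (1 - \<epsilon>) * \<bar>ln \<alpha>\<bar> / D_star \<alpha>"
        using Da by (simp add: pos_le_divide_eq)
      then have n: "?R \<le> real ?n" unfolding N_def by linarith
      then have n_pos: "0 < real ?n" using R by linarith
      have "2 * real \<kappa> / \<epsilon> \<le> real ?n" using n by linarith
      then have \<kappa>: "real \<kappa> \<le> real ?n * (\<epsilon> / 2)"
        using \<epsilon> by (simp add: field_simps)
      have l': "l' \<alpha> = D_star \<alpha>"
        unfolding D_star_def \<Xi>2_def
        using D_block_optimal_policy[OF avg[OF \<alpha>] upsilon2[OF \<alpha>] S0] by simp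
      show ?case
      proof (intro SUP_least)
        fix t \<delta> w
        let ?x = "\<lambda>s. X \<alpha> \<delta> (t + s) w" and ?S = "mem_state S0 (treatments (X \<alpha> \<delta>) t w)"
        have "(\<Sum>s=1..?n. info \<mu> f g (?x s) +
             omega (cp_prob (p0 \<alpha>) (\<Psi> \<alpha>) S0 (treatments (X \<alpha> \<delta>) (t + s) w))) =
            (\<Sum>s=1..?n. reward I (\<Psi> \<alpha>) (?x s) (mem_state ?S (map ?x [1..<s])))"
          unfolding I_def by (intro sum.cong refl reward_eq_history) auto
        also have "\<dots> \<le> (real ?n + real \<kappa>) * l' \<alpha>"
          using avg[OF \<alpha>] elim(1) S0 unfolding I_def
          by (intro reward_sum_le_uniform) auto
        also have "\<dots> \<le> (real ?n + real ?n * (\<epsilon> / 2)) * D_star \<alpha>"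
          unfolding l' using \<kappa> Da by (intro mult_right_mono) auto
        also have "\<dots> = (1 + \<epsilon> / 2) * (D_star \<alpha> * real ?n)"
          by (simp add: algebra_simps)
        finally show "ereal (1 / (D_star \<alpha> * real ?n) * (\<Sum>s=1..?n. info \<mu> f g (?x s) +
             omega (cp_prob (p0 \<alpha>) (\<Psi> \<alpha>) S0 (treatments (X \<alpha> \<delta>) (t + s) w))))
            \<le> ereal (1 + \<epsilon> / 2)"
          using Da n_pos by (simp add: pos_divide_le_eq)
      qed
    qed
  qed
  show ?thesis using part1 part2 part3 part4 by blast
qed

end
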